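(* Let $d\ge1$, $p\in(0,1)$, and for $n\ge3$ let $\mathcal{P}$ be the plaquette-model random cubical complex with parameter $p$. For $j\in\{0,1,\dots,d\}$ put $\widehat V_j(\mathcal{P}):=n^{-d/2}(V_j(\mathcal{P})-\mathbb{E}[V_j(\mathcal{P})])$, where $V_j(\mathcal{P})$ is the $j$-th intrinsic volume of $\mathcal{P}$, and let $\mathbf{W}:=(\widehat V_0(\mathcal{P}),\widehat V_1(\mathcal{P}),\dots,\widehat V_d(\mathcal{P}))$. Let $\Sigma=(\Sigma_{ij})_{i,j=0}^d$ be the matrix given by $$\Sigma_{ij}=\binom di\binom dj\,p(1-p).$$ Then there exists a constant $C=C(p,d)$ only depending on $p$ and on $d$ such that $$d_4(\mathbf{W},\mathbf{N}_\Sigma)\le\frac{C}{n^{d/2}},$$ where $\mathbf{N}_\Sigma$ is a $(d+1)$-dimensional centred Gaussian random vector having covariance matrix $\Sigma$.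
   Context: Plaquette model. Consider the $n^d$ unit cubes $[0,1]^d+z$, $z\in\{0,\dots,n-1\}^d$, with opposite faces of the big cube $[0,n]^d$ identified (torus topology). Let $\mathcal{G}$ be the union of the boundaries $\partial[0,1]^d+z$ of all these cubes. Independently for each of the $n^d$ open $d$-cubes $C_1,\dots,C_{n^d}$ of the form $(0,1)^d+z$, $C_k$ is added to $\mathcal{G}$ with probability $p$ and not added with probability $1-p$. The resulting random set is $\mathcal{P}$; it is a disjoint union of open cubes of dimensions $0,\dots,d$, all open cubes of dimension less than $d$ being always included. Intrinsic volumes. $V_j(\mathcal{P})=\sum_D\xi_{D,j}$, the sum running over all open cubes $D$ (of dimensions $0,\dots,d$) of the lattice, with $\xi_{D,j}=(-1)^{\dim(D)-j}\binom{\dim(D)}{j}\mathbf{1}\{D\text{ belongs to }\mathcal{P}\}$. Binomial coefficients $\binom{m}{j}$ with $j>m$ are $0$. Distance. For $g:\mathbb{R}^r\to\mathbb{R}$ put $M_k(g)=\max_{1\le i_1,\dots,i_k\le r}\big\|\frac{\partial^k g}{\partial x_{i_1}\cdots\partial x_{i_k}}\big\|_\infty$ (supremum norm). For $\mathbb{R}^r$-valued random vectors $\mathbf{X},\mathbf{Y}$, $d_4(\mathbf{X},\mathbf{Y})=\sup_g|\mathbb{E}[g(\mathbf{X})]-\mathbb{E}[g(\mathbf{Y})]|$, where the supremum runs over all four times partially differentiable $g:\mathbb{R}^r\to\mathbb{R}$ with bounded partial derivatives satisfying $M_1(g),M_2(g),M_3(g),M_4(g)\le1$. Here $r=d+1$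.
   Formalization: The covariance matrix is taken as Σ_ij = (-1)^{i+j} C(d,i) C(d,j) p(1-p); the printed formula lacks the sign (-1)^{i+j} and is false with the given V_j (e.g. for d=1 the two components of W sum to 0). *)

theory Defs
  imports "HOL-Probability.Probability" "HOL-Library.Real_Mod"
begin

subsection \<open>The plaquette model\<close>

text \<open>
  The torus is represented by its fundamental domain \<open>[0,n)^d\<close>; points are functions on
  \<open>{..<d}\<close>, extended by \<open>undefined\<close>.
\<close>

definition torus_proj :: "nat \<Rightarrow> nat \<Rightarrow> (nat \<Rightarrow> real) \<Rightarrow> (nat \<Rightarrow> real)" where
  "torus_proj d n x = (\<lambda>i\<in>{..<d}. x i rmod real n)"

definition corners :: "nat \<Rightarrow> nat \<Rightarrow> (nat \<Rightarrow> nat) set" where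
  "corners d n = {..<d} \<rightarrow>\<^sub>E {..<n}"

text \<open>
  The open cube with lower corner \<open>z\<close> that extends in the directions \<open>I\<close>; its dimension is
  \<open>card I\<close>. Every open cube of the torus lattice is \<open>open_cube d z I\<close> for exactly one pair of
  \<open>z \<in> corners d n\<close> and \<open>I \<subseteq> {..<d}\<close>, and it lies in \<open>[0,n)^d\<close>.
\<close>

definition open_cube :: "nat \<Rightarrow> (nat \<Rightarrow> nat) \<Rightarrow> nat set \<Rightarrow> (nat \<Rightarrow> real) set" where
  "open_cube d z I = {x \<in> extensional {..<d}.
     \<forall>i<d. if i \<in> I then real (z i) < x i \<and> x i < real (z i) + 1 else x i = real (z i)}"

definition closed_cube :: "nat \<Rightarrow> (nat \<Rightarrow> nat) \<Rightarrow> (nat \<Rightarrow> real) set" where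
  "closed_cube d z = {x \<in> extensional {..<d}. \<forall>i<d. real (z i) \<le> x i \<and> x i \<le> real (z i) + 1}"

definition cube_boundary :: "nat \<Rightarrow> (nat \<Rightarrow> nat) \<Rightarrow> (nat \<Rightarrow> real) set" where
  "cube_boundary d z = closed_cube d z - open_cube d z {..<d}"

definition grid :: "nat \<Rightarrow> nat \<Rightarrow> (nat \<Rightarrow> real) set" where
  "grid d n = (\<Union>z\<in>corners d n. torus_proj d n ` cube_boundary d z)"

definition plaquette_set :: "nat \<Rightarrow> nat \<Rightarrow> ((nat \<Rightarrow> nat) \<Rightarrow> bool) \<Rightarrow> (nat \<Rightarrow> real) set" where
  "plaquette_set d n \<omega> = grid d n \<union> (\<Union>z\<in>{z \<in> corners d n. \<omega> z}. open_cube d z {..<d})"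

definition plaquette_pmf :: "nat \<Rightarrow> nat \<Rightarrow> real \<Rightarrow> ((nat \<Rightarrow> nat) \<Rightarrow> bool) pmf" where
  "plaquette_pmf d n p = Pi_pmf (corners d n) False (\<lambda>_. bernoulli_pmf p)"

text \<open>Where \<open>card I - j\<close> is truncated, the binomial coefficient is \<open>0\<close>.\<close>

definition xi :: "nat \<Rightarrow> nat \<Rightarrow> (nat \<Rightarrow> real) set \<Rightarrow> (nat \<Rightarrow> nat) \<Rightarrow> nat set \<Rightarrow> real" where
  "xi d j P z I =
     (-1) ^ (card I - j) * real (card I choose j) * of_bool (open_cube d z I \<subseteq> P)"

definition intrinsic_volume :: "nat \<Rightarrow> nat \<Rightarrow> nat \<Rightarrow> (nat \<Rightarrow> real) set \<Rightarrow> real" where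
  "intrinsic_volume d n j P = (\<Sum>(z, I) \<in> corners d n \<times> Pow {..<d}. xi d j P z I)"

definition normalized_volume :: "nat \<Rightarrow> nat \<Rightarrow> real \<Rightarrow> nat \<Rightarrow> ((nat \<Rightarrow> nat) \<Rightarrow> bool) \<Rightarrow> real" where
  "normalized_volume d n p j \<omega> = real n powr (- real d / 2) *
     (intrinsic_volume d n j (plaquette_set d n \<omega>) -
      measure_pmf.expectation (plaquette_pmf d n p)
        (\<lambda>\<omega>'. intrinsic_volume d n j (plaquette_set d n \<omega>')))"

definition W_vec :: "nat \<Rightarrow> nat \<Rightarrow> real \<Rightarrow> ((nat \<Rightarrow> nat) \<Rightarrow> bool) \<Rightarrow> (nat \<Rightarrow> real)" where
  "W_vec d n p \<omega> = (\<lambda>j\<in>{..d}. normalized_volume d n p j \<omega>)"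


subsection \<open>The distance $d_4$\<close>

text \<open>
  The space of real vectors with \<open>r\<close> components is \<open>{..<r} \<rightarrow>\<^sub>E UNIV\<close>, with Borel sets
  \<open>Pi\<^sub>M {..<r} (\<lambda>_. borel)\<close>. The distance depends on the random vectors only through their
  laws, so it is defined on laws.
\<close>

definition Rvec :: "nat \<Rightarrow> (nat \<Rightarrow> real) measure" where
  "Rvec r = Pi\<^sub>M {..<r} (\<lambda>_. borel)"

definition partial_deriv :: "nat \<Rightarrow> ((nat \<Rightarrow> real) \<Rightarrow> real) \<Rightarrow> ((nat \<Rightarrow> real) \<Rightarrow> real)" where
  "partial_deriv i g x = deriv (\<lambda>t. g (x(i := t))) (x i)"

definition iter_partial :: "nat list \<Rightarrow> ((nat \<Rightarrow> real) \<Rightarrow> real) \<Rightarrow> ((nat \<Rightarrow> real) \<Rightarrow> real)" where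
  "iter_partial is g = foldr partial_deriv is g"

definition partially_differentiable ::
    "nat \<Rightarrow> nat \<Rightarrow> ((nat \<Rightarrow> real) \<Rightarrow> real) \<Rightarrow> bool" where
  "partially_differentiable r k g \<longleftrightarrow>
     (\<forall>is i x. length is < k \<longrightarrow> set is \<subseteq> {..<r} \<longrightarrow> i < r \<longrightarrow> x \<in> ({..<r} \<rightarrow>\<^sub>E UNIV) \<longrightarrow>
        (\<lambda>t. iter_partial is g (x(i := t))) differentiable (at (x i)))"

definition M_norm :: "nat \<Rightarrow> nat \<Rightarrow> ((nat \<Rightarrow> real) \<Rightarrow> real) \<Rightarrow> ereal" where
  "M_norm r k g = (MAX is \<in> {is. set is \<subseteq> {..<r} \<and> length is = k}.
     SUP x \<in> {..<r} \<rightarrow>\<^sub>E UNIV. ereal \<bar>iter_partial is g x\<bar>)"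

text \<open>As \<open>M_norm\<close> may be \<open>\<infinity>\<close>, the bounds by \<open>1\<close> include boundedness of the partial derivatives.\<close>

definition d4_test_functions :: "nat \<Rightarrow> ((nat \<Rightarrow> real) \<Rightarrow> real) set" where
  "d4_test_functions r = {g. partially_differentiable r 4 g \<and>
     M_norm r 1 g \<le> 1 \<and> M_norm r 2 g \<le> 1 \<and> M_norm r 3 g \<le> 1 \<and> M_norm r 4 g \<le> 1}"

definition d4 :: "nat \<Rightarrow> (nat \<Rightarrow> real) measure \<Rightarrow> (nat \<Rightarrow> real) measure \<Rightarrow> ereal" where
  "d4 r \<mu> \<nu> = (SUP g \<in> d4_test_functions r. ereal \<bar>(\<integral>x. g x \<partial>\<mu>) - (\<integral>x. g x \<partial>\<nu>)\<bar>)"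


subsection \<open>Gaussian vectors\<close>

definition normal_law :: "real \<Rightarrow> real \<Rightarrow> real measure" where
  "normal_law m \<sigma> = (if \<sigma> = 0 then return borel m else density lborel (normal_density m \<sigma>))"

text \<open>
  Gaussian vectors are defined through their linear combinations, so that singular covariance
  matrices are allowed. The integrals below exist since the components are normal.
\<close>

definition centred_gaussian ::
    "nat \<Rightarrow> (nat \<Rightarrow> nat \<Rightarrow> real) \<Rightarrow> (nat \<Rightarrow> real) measure \<Rightarrow> bool" where
  "centred_gaussian r S \<nu> \<longleftrightarrow>
     prob_space \<nu> \<and> sets \<nu> = sets (Rvec r) \<and>
     (\<forall>a. \<exists>m \<sigma>. 0 \<le> \<sigma> \<and> distr \<nu> borel (\<lambda>x. \<Sum>i<r. a i * x i) = normal_law m \<sigma>) \<and>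
     (\<forall>i<r. (\<integral>x. x i \<partial>\<nu>) = 0) \<and>
     (\<forall>i<r. \<forall>j<r. (\<integral>x. x i * x j \<partial>\<nu>) = S i j)"

text \<open>
  When present, a \<open>d\<close>-cube \<open>D\<close> adds \<open>(-1) ^ (d - i) * (d choose i)\<close> to the \<open>i\<close>-th intrinsic
  volume, and the other cubes are always present. Hence the covariances of the intrinsic volumes
  carry the sign \<open>(-1) ^ (i + j)\<close>, see \<open>covariance_W_vec\<close>. The printed formula for
  the limit covariance lacks this sign; without it the vector does not converge to the Gaussian
  vector (for \<open>d = 1\<close> the two components of \<open>W_vec\<close> add up to \<open>0\<close>, so their covariance is
  negative).
\<close>

definition Sigma_mat :: "nat \<Rightarrow> real \<Rightarrow> nat \<Rightarrow> nat \<Rightarrow> real" where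
  "Sigma_mat d p i j = (-1) ^ (i + j) * real (d choose i) * real (d choose j) * p * (1 - p)"


subsection \<open>The covariances and the existence of the Gaussian vector\<close>

lemma finite_corners [simp]: "finite (corners d n)"
  by (simp add: corners_def finite_PiE)

lemma card_corners: "card (corners d n) = n ^ d"
  by (simp add: corners_def card_PiE)

lemma open_cube_subset_grid:
  assumes z: "z \<in> corners d n" and I: "I \<subset> {..<d}"
  shows "open_cube d z I \<subseteq> grid d n"
proof
  fix x assume x: "x \<in> open_cube d z I"
  obtain i where i: "i < d" "i \<notin> I" using I by blast
  have zn: "z k < n" if "k < d" for k using z that by (auto simp: corners_def)
  have b: "real (z k) \<le> x k \<and> x k < real (z k) + 1" if "k < d" for k
  proof -
    have "if k \<in> I then real (z k) < x k \<and> x k < real (z k) + 1 else x k = real (z k)"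
      using x that unfolding open_cube_def by blast
    then show ?thesis by (auto split: if_splits)
  qed
  have xi: "x i = real (z i)" using x i unfolding open_cube_def by auto
  have ext: "x \<in> extensional {..<d}" using x by (simp add: open_cube_def)
  have "x \<in> closed_cube d z"
    using ext b by (simp add: closed_cube_def less_imp_le)
  moreover have "x \<notin> open_cube d z {..<d}"
    using i xi unfolding open_cube_def by auto
  moreover have "torus_proj d n x = x"
  proof
    fix k show "torus_proj d n x k = x k"
    proof (cases "k < d")
      case True
      have "real (z k) + 1 \<le> real n" using zn[OF True] by linarith
      then have "x k rmod real n = x k"
        using b[OF True] by (intro rmod_unique[where n=0]) auto
      then show ?thesis using True by (simp add: torus_proj_def)
    next
      case False then show ?thesis using ext by (auto simp: torus_proj_def extensional_def)
    qed
  qed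
  ultimately have "x \<in> torus_proj d n ` cube_boundary d z"
    by (intro image_eqI[of _ _ x]) (simp_all add: cube_boundary_def)
  then show "x \<in> grid d n" unfolding grid_def using z by (rule UN_I[rotated])
qed

lemma rmod_of_nat_Ints: "real a rmod real n \<in> \<int>"
  unfolding rmod_def by (intro Ints_diff Ints_mult) auto

lemma open_cube_subset_plaquette_set_iff:
  assumes z: "z \<in> corners d n"
  shows "open_cube d z {..<d} \<subseteq> plaquette_set d n \<omega> \<longleftrightarrow> \<omega> z"
proof
  assume "\<omega> z" then show "open_cube d z {..<d} \<subseteq> plaquette_set d n \<omega>"
    using z unfolding plaquette_set_def by blast
next
  assume sub: "open_cube d z {..<d} \<subseteq> plaquette_set d n \<omega>"
  define x where "x = (\<lambda>i\<in>{..<d}. real (z i) + 1/2)"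
  have "x \<in> open_cube d z {..<d}" by (auto simp: x_def open_cube_def)
  then have "x \<in> plaquette_set d n \<omega>" using sub by blast
  moreover have "x \<notin> grid d n"
  proof
    assume "x \<in> grid d n"
    then obtain z' y where y: "y \<in> cube_boundary d z'" "x = torus_proj d n y"
      unfolding grid_def by blast
    then obtain i where i: "i < d" "y i = real (z' i) \<or> y i = real (z' i) + 1"
      unfolding cube_boundary_def closed_cube_def open_cube_def
      by (auto simp: less_le)
    have "y i rmod real n \<in> \<int>"
      using i(2) rmod_of_nat_Ints[of "z' i" n] rmod_of_nat_Ints[of "z' i + 1" n] by (auto simp: add.commute)
    then have "x i \<in> \<int>" using y(2) i(1) by (simp add: torus_proj_def)
    then have "real (z i) + 1/2 \<in> \<int>" using i(1) by (simp add: x_def)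
    then obtain k :: int where "real (z i) + 1/2 = of_int k" by (auto elim: Ints_cases)
    then have "2 * int (z i) + 1 = 2 * k" by linarith
    then show False by presburger
  qed
  ultimately obtain z' where z': "z' \<in> corners d n" "\<omega> z'" "x \<in> open_cube d z' {..<d}"
    unfolding plaquette_set_def by blast
  have "z' = z"
  proof (rule PiE_ext[OF z'(1)[unfolded corners_def] z[unfolded corners_def]])
    fix i assume "i \<in> {..<d}"
    then have "real (z' i) < real (z i) + 1/2 \<and> real (z i) + 1/2 < real (z' i) + 1"
      using z'(3) unfolding open_cube_def by (auto simp: x_def)
    then show "z' i = z i" by linarith
  qed
  then show "\<omega> z" using z' by simp
qed

lemma intrinsic_volume_eq:
  obtains c where "\<And>\<omega>. intrinsic_volume d n j (plaquette_set d n \<omega>) =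
    c + (-1) ^ (d - j) * real (d choose j) * real (card {z \<in> corners d n. \<omega> z})"
proof
  fix \<omega>
  let ?P = "plaquette_set d n \<omega>" and ?Q = "Pow {..<d} - {{..<d}}"
  have "intrinsic_volume d n j ?P = (\<Sum>z\<in>corners d n. \<Sum>I\<in>Pow {..<d}. xi d j ?P z I)"
    unfolding intrinsic_volume_def by (rule sum.cartesian_product[symmetric])
  also have "\<dots> = (\<Sum>z\<in>corners d n. (\<Sum>I\<in>?Q. xi d j ?P z I) + xi d j ?P z {..<d})"
    by (intro sum.cong refl, subst sum.remove[of _ "{..<d}"]) auto
  also have "\<dots> = (\<Sum>z\<in>corners d n. (\<Sum>I\<in>?Q. (-1) ^ (card I - j) * real (card I choose j))
      + (-1) ^ (d - j) * real (d choose j) * of_bool (\<omega> z))"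
  proof (intro sum.cong refl arg_cong2[of _ _ _ _ "(+)"])
    fix z I assume z: "z \<in> corners d n"
    { assume "I \<in> ?Q"
      then have "open_cube d z I \<subseteq> ?P"
        using open_cube_subset_grid[OF z, of I] by (auto simp: plaquette_set_def)
      then show "xi d j ?P z I = (-1) ^ (card I - j) * real (card I choose j)"
        by (simp add: xi_def) }
    show "xi d j ?P z {..<d} = (-1) ^ (d - j) * real (d choose j) * of_bool (\<omega> z)"
      by (simp add: xi_def open_cube_subset_plaquette_set_iff[OF z])
  qed
  also have "\<dots> = (\<Sum>z\<in>corners d n. (\<Sum>I\<in>?Q. (-1) ^ (card I - j) * real (card I choose j)))
      + (-1) ^ (d - j) * real (d choose j) * (\<Sum>z\<in>corners d n. of_bool (\<omega> z))"
    by (simp only: sum.distrib sum_distrib_left)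
  also have "(\<Sum>z\<in>corners d n. of_bool (\<omega> z)) = real (card {z \<in> corners d n. \<omega> z})"
    by (simp add: of_bool_def sum.If_cases Int_def)
  finally show "intrinsic_volume d n j ?P =
    (\<Sum>z\<in>corners d n. (\<Sum>I\<in>?Q. (-1) ^ (card I - j) * real (card I choose j)))
      + (-1) ^ (d - j) * real (d choose j) * real (card {z \<in> corners d n. \<omega> z})" .
qed

lemma binomial_pmf_moments:
  assumes p: "0 \<le> p" "p \<le> 1"
  shows "measure_pmf.expectation (binomial_pmf N p) real = real N * p"
    and "measure_pmf.expectation (binomial_pmf N p) (\<lambda>k. (real k - real N * p)\<^sup>2) = real N * p * (1 - p)"
proof -
  have e: "measure_pmf.expectation (binomial_pmf N p) f = (\<Sum>k\<le>N. f k * Bernstein N k p)" for f :: "nat \<Rightarrow> real"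
    using p by (subst expectation_binomial_pmf') (auto simp: Bernstein_def intro!: sum.cong)
  show "measure_pmf.expectation (binomial_pmf N p) real = real N * p"
    by (simp add: e sum_k_Bernstein)
  have "(real k - real N * p)\<^sup>2 * B = real k * (real k - 1) * B + (1 - 2 * (real N * p)) * (real k * B)
      + (real N * p)\<^sup>2 * B" for k B
    by (simp add: power2_eq_square algebra_simps)
  then have "(\<Sum>k\<le>N. (real k - real N * p)\<^sup>2 * Bernstein N k p) =
    (\<Sum>k\<le>N. real k * (real k - 1) * Bernstein N k p) + (1 - 2 * (real N * p)) * (\<Sum>k\<le>N. real k * Bernstein N k p)
      + (real N * p)\<^sup>2 * (\<Sum>k\<le>N. Bernstein N k p)"
    by (simp only: sum_distrib_left sum.distrib)
  also have "\<dots> = real N * p * (1 - p)"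
    unfolding sum_k_Bernstein sum_kk_Bernstein sum_Bernstein
    by (simp add: power2_eq_square algebra_simps)
  finally show "measure_pmf.expectation (binomial_pmf N p) (\<lambda>k. (real k - real N * p)\<^sup>2) = real N * p * (1 - p)"
    by (simp add: e)
qed

lemma covariance_W_vec:
  assumes "0 \<le> p" "p \<le> 1" "n > 0" "i \<le> d" "j \<le> d"
  shows "measure_pmf.expectation (plaquette_pmf d n p) (\<lambda>\<omega>. W_vec d n p \<omega> i * W_vec d n p \<omega> j)
    = Sigma_mat d p i j"
proof -
  let ?B = "\<lambda>\<omega>. card {z \<in> corners d n. \<omega> z}" and ?P = "plaquette_pmf d n p"
  let ?a = "\<lambda>k. (-1) ^ (d - k) * real (d choose k)" and ?s = "real n powr (- real d / 2)"
  have bin: "map_pmf ?B ?P = binomial_pmf (n ^ d) p"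
    unfolding plaquette_pmf_def using assms
    by (intro binomial_pmf_altdef'[symmetric]) (auto simp: card_corners)
  have E: "measure_pmf.expectation ?P (\<lambda>\<omega>. f (?B \<omega>)) = measure_pmf.expectation (binomial_pmf (n ^ d) p) f"
    for f :: "nat \<Rightarrow> real" by (simp add: bin[symmetric])
  have int: "integrable ?P (\<lambda>\<omega>. f (?B \<omega>))" for f :: "nat \<Rightarrow> real"
  proof -
    have "integrable (measure_pmf (map_pmf ?B ?P)) f" using assms by (simp add: bin)
    then show ?thesis by simp
  qed
  have W: "W_vec d n p \<omega> k = ?s * (?a k * (real (?B \<omega>) - real (n ^ d) * p))" if "k \<le> d" for k \<omega>
  proof -
    obtain c where c: "\<And>\<omega>. intrinsic_volume d n k (plaquette_set d n \<omega>) = c + ?a k * real (?B \<omega>)"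
      by (rule intrinsic_volume_eq[of d n k]) blast
    have "measure_pmf.expectation ?P (\<lambda>\<omega>. c + ?a k * real (?B \<omega>)) = c + ?a k * (real (n ^ d) * p)"
      using E[of "\<lambda>m. c + ?a k * real m"] binomial_pmf_moments(1)[of p "n ^ d"] assms
      by (simp add: Bochner_Integration.integral_add)
    then have "normalized_volume d n p k \<omega> =
        ?s * (c + ?a k * real (?B \<omega>) - (c + ?a k * (real (n ^ d) * p)))"
      unfolding normalized_volume_def c by simp
    then show ?thesis
      using that by (simp add: W_vec_def algebra_simps)
  qed
  have s: "?s * ?s * real (n ^ d) = 1"
  proof -
    have "?s * ?s = real n powr (- real d)" by (simp add: powr_add[symmetric])
    also have "\<dots> = inverse (real (n ^ d))" using assms by (simp add: powr_minus powr_realpow)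
    finally show ?thesis using assms by simp
  qed
  have sg: "(-1::real) ^ (d - i) * (-1) ^ (d - j) = (-1) ^ (i + j)"
    using assms by (simp add: minus_one_power_iff)
  have "measure_pmf.expectation ?P (\<lambda>\<omega>. W_vec d n p \<omega> i * W_vec d n p \<omega> j) =
     measure_pmf.expectation ?P (\<lambda>\<omega>. (?s * ?s * ?a i * ?a j) * (real (?B \<omega>) - real (n ^ d) * p)\<^sup>2)"
    using assms by (simp add: W power2_eq_square mult_ac)
  also have "\<dots> = (?s * ?s * ?a i * ?a j) * (real (n ^ d) * p * (1 - p))"
    using E[of "\<lambda>m. (real m - real (n ^ d) * p)\<^sup>2"] binomial_pmf_moments(2)[of p "n ^ d"] assms
    by simp
  also have "\<dots> = (?s * ?s * real (n ^ d)) * (?a i * ?a j * p * (1 - p))" by (simp only: mult_ac)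
  also have "\<dots> = ((-1) ^ (d - i) * (-1) ^ (d - j)) * real (d choose i) * real (d choose j) * p * (1 - p)"
    unfolding s by (simp only: mult_ac mult_1_left)
  finally show ?thesis unfolding sg Sigma_mat_def .
qed

lemma centred_gaussian_rank_one:
  fixes b :: "nat \<Rightarrow> real"
  shows "centred_gaussian r (\<lambda>i j. b i * b j)
    (distr (density lborel std_normal_density) (Rvec r) (\<lambda>z. \<lambda>i\<in>{..<r}. b i * z))"
proof -
  define N where "N = density lborel (\<lambda>x. ennreal (std_normal_density x))"
  define X where "X z = (\<lambda>i\<in>{..<r}. b i * z)" for z :: real
  define \<nu> where "\<nu> = distr N (Rvec r) X"
  interpret N: prob_space N
    unfolding N_def by (intro prob_space_normal_density) auto
  have setsN [measurable_cong, simp]: "sets N = sets borel" by (simp add: N_def)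
  have [measurable]: "X \<in> measurable N (Rvec (r))"
    unfolding X_def Rvec_def by measurable
  have comp: "(\<lambda>x. x i) \<in> borel_measurable (Rvec (r))" if "i < r" for i
    unfolding Rvec_def using that by (intro measurable_component_singleton) auto
  have N1: "integral\<^sup>L N (\<lambda>z. z) = 0" and N2: "integral\<^sup>L N (\<lambda>z. z * z) = 1"
    unfolding N_def using integral_std_normal_moment_odd[of 0] integral_std_normal_moment_even[of 1]
    by (simp_all add: integral_density power2_eq_square)
  have lin: "\<exists>m \<sigma>. 0 \<le> \<sigma> \<and> distr \<nu> borel (\<lambda>x. \<Sum>i<r. a i * x i) = normal_law m \<sigma>" for a
  proof -
    define c where "c = (\<Sum>i<r. a i * b i)"
    have "distr \<nu> borel (\<lambda>x. \<Sum>i<r. a i * x i) = distr N borel (\<lambda>z. \<Sum>i<r. a i * X z i)"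
      unfolding \<nu>_def by (subst distr_distr) (auto intro!: borel_measurable_sum borel_measurable_times comp simp: o_def)
    also have "(\<lambda>z. \<Sum>i<r. a i * X z i) = (\<lambda>z. c * z)"
      by (auto simp: X_def c_def sum_distrib_left sum_distrib_right mult_ac intro!: sum.cong)
    finally have eq: "distr \<nu> borel (\<lambda>x. \<Sum>i<r. a i * x i) = distr N borel (\<lambda>z. c * z)" .
    show ?thesis
    proof (cases "c = 0")
      case True
      then have "distr N borel (\<lambda>z. c * z) = return borel 0" by (simp add: N.distr_const)
      then show ?thesis using eq by (intro exI[of _ 0]) (simp add: normal_law_def)
    next
      case False
      have "distributed N lborel (\<lambda>x. x) std_normal_density"
        unfolding distributed_def by (auto simp: N_def distr_id2 cong: distr_cong)
      from N.normal_density_affine[OF this _ False, of 0]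
      have "distributed N lborel (\<lambda>z. c * z) (normal_density 0 \<bar>c\<bar>)" by simp
      then have "distr N lborel (\<lambda>z. c * z) = density lborel (normal_density 0 \<bar>c\<bar>)"
        by (simp add: distributed_def)
      moreover have "distr N lborel (\<lambda>z. c * z) = distr N borel (\<lambda>z. c * z)"
        by (rule distr_cong) auto
      ultimately show ?thesis using eq False
        by (intro exI[of _ 0] exI[of _ "\<bar>c\<bar>"]) (simp add: normal_law_def)
    qed
  qed
  have "centred_gaussian r (\<lambda>i j. b i * b j) \<nu>"
    unfolding centred_gaussian_def
  proof (intro conjI allI impI)
    show "prob_space \<nu>" unfolding \<nu>_def by (rule N.prob_space_distr) measurable
    show "sets \<nu> = sets (Rvec (r))" by (simp add: \<nu>_def)
    show "\<exists>m \<sigma>. 0 \<le> \<sigma> \<and> distr \<nu> borel (\<lambda>x. \<Sum>i<r. a i * x i) = normal_law m \<sigma>" for a by (rule lin)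
    fix i assume i: "i < r"
    show "(\<integral>x. x i \<partial>\<nu>) = 0"
      unfolding \<nu>_def by (subst integral_distr) (use i comp N1 in \<open>auto simp: X_def\<close>)
    fix j assume j: "j < r"
    have "(\<integral>x. x i * x j \<partial>\<nu>) = (\<integral>z. (b i * b j) * (z * z) \<partial>N)"
      unfolding \<nu>_def by (subst integral_distr) (use i j in \<open>auto simp: X_def mult_ac intro!: borel_measurable_times comp\<close>)
    also have "\<dots> = b i * b j" unfolding integral_mult_right_zero N2 by simp
    finally show "(\<integral>x. x i * x j \<partial>\<nu>) = b i * b j" .
  qed
  then show ?thesis unfolding \<nu>_def N_def X_def .
qed

lemma centred_gaussian_exists:
  assumes "0 < p" "p < 1"
  shows "\<exists>\<nu>. centred_gaussian (d + 1) (Sigma_mat d p) \<nu>"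
proof -
  define b where "b i = (-1) ^ i * real (d choose i) * sqrt (p * (1 - p))" for i
  have "b i * b j = Sigma_mat d p i j" for i j
  proof -
    have "b i * b j = (-1) ^ (i + j) * real (d choose i) * real (d choose j) *
        (sqrt (p * (1 - p)) * sqrt (p * (1 - p)))"
      unfolding b_def by (simp only: power_add mult_ac)
    also have "sqrt (p * (1 - p)) * sqrt (p * (1 - p)) = p * (1 - p)" using assms by simp
    finally show ?thesis by (simp add: Sigma_mat_def)
  qed
  then have "(\<lambda>i j. b i * b j) = Sigma_mat d p" by blast
  then show ?thesis using centred_gaussian_rank_one[of "d + 1" b] by auto
qed

end

theory Submission
  imports Defs
begin

text \<open>
  Only the number of present \<open>d\<close>-cubes is random, so the vector is a fixed multiple \<open>Y c\<close> of a
  centred and rescaled binomial variable \<open>Y\<close>. The covariance matrix has rank one, so a Gaussian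
  vector with this covariance is almost surely \<open>Z c\<close> with \<open>Z\<close> normal. This reduces the claim to
  the one-dimensional functions \<open>h t = g (t c)\<close>. Bounded third partial derivatives of \<open>g\<close> give
  \<open>h\<close> a second-order expansion with a uniform cubic remainder; this property is preserved by
  averaging over Bernoulli steps, so exchanging the \<open>n ^ d\<close> steps for Gaussian ones, one at a
  time (Lindeberg), costs \<open>O(n powr (-3 d / 2))\<close> each and \<open>O(n powr (-d / 2))\<close> altogether.
\<close>

subsection \<open>Binomial approximation by the normal law\<close>

text \<open>\<open>A\<close> and \<open>B\<close> stand for the first derivative and half the second
  derivative of \<open>f\<close>. Keeping them as arbitrary functions of the base point lets them be
  averaged together with \<open>f\<close>, with the same \<open>K\<close>.\<close>

definition cubic_expansion :: "real \<Rightarrow> (real \<Rightarrow> real) \<Rightarrow> bool" where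
  "cubic_expansion K f \<longleftrightarrow>
     (\<exists>A B. \<forall>x u. \<bar>f (x + u) - f x - A x * u - B x * u\<^sup>2\<bar> \<le> K * \<bar>u\<bar> ^ 3)"

section \<open>Centred normal laws: moments and convolution\<close>

definition normal_measure :: "real \<Rightarrow> real measure" where
  "normal_measure \<sigma> = density lborel (normal_density 0 \<sigma>)"

lemma sets_normal_measure [measurable_cong, simp]: "sets (normal_measure \<sigma>) = sets borel"
  and space_normal_measure [simp]: "space (normal_measure \<sigma>) = UNIV"
  by (simp_all add: normal_measure_def)

lemma prob_space_normal_measure: "\<sigma> > 0 \<Longrightarrow> prob_space (normal_measure \<sigma>)"
  unfolding normal_measure_def by (rule prob_space_normal_density)

lemma normal_measure_moments:
  assumes "\<sigma> > 0"
  shows "has_bochner_integral (normal_measure \<sigma>) (\<lambda>z. z) 0"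
    and "has_bochner_integral (normal_measure \<sigma>) (\<lambda>z. z\<^sup>2) (\<sigma>\<^sup>2)"
    and "has_bochner_integral (normal_measure \<sigma>) (\<lambda>z. \<bar>z\<bar> ^ 3) (2 * \<sigma> ^ 3 * sqrt (2 / pi))"
proof -
  have d: "has_bochner_integral (normal_measure \<sigma>) f c"
    if "has_bochner_integral lborel (\<lambda>x. normal_density 0 \<sigma> x * f x) c" "f \<in> borel_measurable borel"
    for f :: "real \<Rightarrow> real" and c
    unfolding normal_measure_def using that by (intro has_bochner_integral_density) auto
  show "has_bochner_integral (normal_measure \<sigma>) (\<lambda>z. z) 0"
    using normal_moment_odd[OF assms, of 0 0] by (intro d) auto
  show "has_bochner_integral (normal_measure \<sigma>) (\<lambda>z. z\<^sup>2) (\<sigma>\<^sup>2)"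
    using normal_moment_even[OF assms, of 0 1] by (intro d) auto
  \<comment> \<open>The formula
    \<open>2 ^ k * fact k * \<sigma> ^ (2 * k + 1) * sqrt (2 / pi)\<close> for odd absolute moments,
    at \<open>k = 1\<close>.\<close>
  show "has_bochner_integral (normal_measure \<sigma>) (\<lambda>z. \<bar>z\<bar> ^ 3) (2 * \<sigma> ^ 3 * sqrt (2 / pi))"
    using normal_moment_abs_odd[OF assms, of 0 1] by (intro d) (auto simp: numeral_3_eq_3)
qed

lemma normal_measure_moment3_le:
  assumes "\<sigma> > 0"
  shows "(\<integral>z. \<bar>z\<bar> ^ 3 \<partial>normal_measure \<sigma>) \<le> 2 * \<sigma> ^ 3"
proof -
  have "sqrt (2 / pi) \<le> 1" using pi_gt3 by simp
  then have "2 * \<sigma> ^ 3 * sqrt (2 / pi) \<le> 2 * \<sigma> ^ 3 * 1"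
    using assms by (intro mult_left_mono) auto
  then show ?thesis
    using has_bochner_integral_integral_eq[OF normal_measure_moments(3)[OF assms]] by simp
qed

text \<open>The remainder of the expansion is dominated by a multiple of the third absolute moment,
  and the quadratic polynomial that was subtracted is integrable. Adding it back covers unbounded
  \<open>f\<close>.\<close>

lemma integrable_cubic_expansion:
  assumes f: "cubic_expansion K f" and [measurable]: "f \<in> borel_measurable borel" and "\<sigma> > 0"
  shows "integrable (normal_measure \<sigma>) (\<lambda>z. f (x + z))"
proof -
  interpret prob_space "normal_measure \<sigma>" by (rule prob_space_normal_measure) fact
  obtain A B where AB: "\<And>x u. \<bar>f (x + u) - f x - A x * u - B x * u\<^sup>2\<bar> \<le> K * \<bar>u\<bar> ^ 3"
    using f unfolding cubic_expansion_def by blast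
  note [simp] = normal_measure_moments[OF \<open>\<sigma> > 0\<close>, THEN integrable.intros]
  have "integrable (normal_measure \<sigma>) (\<lambda>z. f (x + z) - f x - A x * z - B x * z\<^sup>2)"
    by (rule Bochner_Integration.integrable_bound[of _ "\<lambda>z. K * \<bar>z\<bar> ^ 3"])
       (auto intro!: AE_I2 order_trans[OF AB])
  then have "integrable (normal_measure \<sigma>)
      (\<lambda>z. (f (x + z) - f x - A x * z - B x * z\<^sup>2) + f x + A x * z + B x * z\<^sup>2)"
    by (intro Bochner_Integration.integrable_add integrable_const integrable_mult_right) auto
  then show ?thesis by simp
qed

lemma normal_measure_convolution:
  assumes "\<sigma> > 0" "\<tau> > 0"
  shows "normal_measure \<sigma> \<star> normal_measure \<tau> = normal_measure (sqrt (\<sigma>\<^sup>2 + \<tau>\<^sup>2))"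
proof -
  have fin: "finite_measure (normal_measure s)" if "s > 0" for s
    using prob_space_normal_measure[OF that] by (simp add: prob_space.finite_measure)
  show ?thesis
    unfolding normal_measure_def
    by (subst convolution_density)
       (use assms fin conv_normal_density_zero_mean[OF assms] in
         \<open>auto simp: normal_measure_def ennreal_mult'[symmetric]\<close>)
qed

text \<open>Splits a Gaussian increment into two independent ones: the law with the larger variance
  is the image of a product measure under addition, so Fubini applies.\<close>

lemma integral_normal_measure_add:
  fixes f :: "real \<Rightarrow> real"
  assumes [measurable]: "f \<in> borel_measurable borel" and pos: "\<sigma> > 0" "\<tau> > 0"
    and int: "integrable (normal_measure (sqrt (\<sigma>\<^sup>2 + \<tau>\<^sup>2))) f"
  shows "(\<integral>z. f z \<partial>normal_measure (sqrt (\<sigma>\<^sup>2 + \<tau>\<^sup>2))) =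
    (\<integral>z. (\<integral>w. f (z + w) \<partial>normal_measure \<tau>) \<partial>normal_measure \<sigma>)"
proof -
  interpret S: prob_space "normal_measure \<sigma>" by (rule prob_space_normal_measure) fact
  interpret T: prob_space "normal_measure \<tau>" by (rule prob_space_normal_measure) fact
  interpret P: pair_prob_space "normal_measure \<sigma>" "normal_measure \<tau>" ..
  have conv: "normal_measure (sqrt (\<sigma>\<^sup>2 + \<tau>\<^sup>2)) =
      distr (normal_measure \<sigma> \<Otimes>\<^sub>M normal_measure \<tau>) borel (\<lambda>(z, w). z + w)"
    using normal_measure_convolution[OF pos] by (simp add: convolution_def)
  have "integrable (normal_measure \<sigma> \<Otimes>\<^sub>M normal_measure \<tau>) (\<lambda>(z, w). f (z + w))"
    using int unfolding conv by (subst (asm) integrable_distr_eq) (auto simp: split_beta')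
  from P.integral_fst'[OF this]
  show ?thesis
    unfolding conv by (subst integral_distr) (auto simp: split_beta')
qed

section \<open>Bernoulli steps and their exchange for Gaussian ones\<close>

definition bernoulli_step :: "real \<Rightarrow> real \<Rightarrow> (real \<Rightarrow> real) \<Rightarrow> real \<Rightarrow> real" where
  "bernoulli_step p \<delta> f x = p * f (x + \<delta> * (1 - p)) + (1 - p) * f (x - \<delta> * p)"

lemma bernoulli_step_measurable [measurable]:
  assumes [measurable]: "f \<in> borel_measurable borel"
  shows "bernoulli_step p \<delta> f \<in> borel_measurable borel"
  unfolding bernoulli_step_def[abs_def] by measurable

text \<open>\<open>bernoulli_step p \<delta> f x\<close> is the expectation of
  \<open>f (x + \<delta> * (X - p))\<close> for a Bernoulli variable \<open>X\<close>. It is linear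
  in \<open>f\<close>, so with \<open>A\<close> and \<open>B\<close> averaged in the same way the
  new remainder is a convex combination of two old remainders at shifted base points.\<close>

lemma cubic_expansion_bernoulli_step:
  assumes f: "cubic_expansion K f" and p: "0 \<le> p" "p \<le> 1"
  shows "cubic_expansion K (bernoulli_step p \<delta> f)"
proof -
  obtain A B where AB: "\<And>x u. \<bar>f (x + u) - f x - A x * u - B x * u\<^sup>2\<bar> \<le> K * \<bar>u\<bar> ^ 3"
    using f unfolding cubic_expansion_def by blast
  have "\<bar>bernoulli_step p \<delta> f (x + u) - bernoulli_step p \<delta> f x
      - bernoulli_step p \<delta> A x * u - bernoulli_step p \<delta> B x * u\<^sup>2\<bar> \<le> K * \<bar>u\<bar> ^ 3" for x u
  proof -
    define R where "R y = f (y + u) - f y - A y * u - B y * u\<^sup>2" for y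
    have "bernoulli_step p \<delta> f (x + u) - bernoulli_step p \<delta> f x
        - bernoulli_step p \<delta> A x * u - bernoulli_step p \<delta> B x * u\<^sup>2 = bernoulli_step p \<delta> R x"
      by (simp add: bernoulli_step_def R_def algebra_simps)
    also have "\<bar>\<dots>\<bar> \<le> p * \<bar>R (x + \<delta> * (1 - p))\<bar> + (1 - p) * \<bar>R (x - \<delta> * p)\<bar>"
      unfolding bernoulli_step_def using p
      by (intro order_trans[OF abs_triangle_ineq] add_mono) (auto simp: abs_mult)
    also have "\<dots> \<le> p * (K * \<bar>u\<bar> ^ 3) + (1 - p) * (K * \<bar>u\<bar> ^ 3)"
      unfolding R_def using p by (intro add_mono mult_left_mono AB) auto
    finally show ?thesis by (simp add: algebra_simps)
  qed
  then show ?thesis unfolding cubic_expansion_def by blast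
qed

text \<open>Conditioning on the outcome of a single trial, which is independent of the remaining
  \<open>n\<close>.\<close>

lemma expectation_binomial_pmf_Suc:
  fixes f :: "nat \<Rightarrow> real"
  assumes p: "0 \<le> p" "p \<le> 1"
  shows "measure_pmf.expectation (binomial_pmf (Suc n) p) f =
    measure_pmf.expectation (binomial_pmf n p) (\<lambda>k. p * f (Suc k) + (1 - p) * f k)"
proof -
  have "binomial_pmf (Suc n) p =
      bernoulli_pmf p \<bind> (\<lambda>b. map_pmf (\<lambda>k. (if b then 1 else 0) + k) (binomial_pmf n p))"
    using p by (subst binomial_pmf_Suc) (auto simp: map_pmf_def)
  also have "measure_pmf.expectation \<dots> f =
      measure_pmf.expectation (bernoulli_pmf p)
        (\<lambda>b. measure_pmf.expectation (binomial_pmf n p) (\<lambda>k. f ((if b then 1 else 0) + k)))"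
    using p by (subst pmf_expectation_bind[where A = UNIV]) 
       (auto intro!: finite_imageI simp: UNIV_bool integral_measure_pmf[of UNIV])
  also have "\<dots> = p * measure_pmf.expectation (binomial_pmf n p) (\<lambda>k. f (Suc k)) +
      (1 - p) * measure_pmf.expectation (binomial_pmf n p) f"
    using p by (simp add: UNIV_bool integral_measure_pmf[of UNIV])
  finally show ?thesis
    using p by (simp add: Bochner_Integration.integral_add)
qed

text \<open>Both laws have mean \<open>0\<close> and the same variance, so only the cubic remainders survive.\<close>

lemma bernoulli_step_normal:
  assumes f: "cubic_expansion K f" and [measurable]: "f \<in> borel_measurable borel"
    and p: "0 < p" "p < 1" and \<delta>: "\<delta> > 0" and \<sigma>: "\<sigma> > 0" "\<sigma>\<^sup>2 = \<delta>\<^sup>2 * (p * (1 - p))"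
  shows "\<bar>bernoulli_step p \<delta> f x - (\<integral>z. f (x + z) \<partial>normal_measure \<sigma>)\<bar> \<le> 3 * K * \<delta> ^ 3"
proof -
  interpret prob_space "normal_measure \<sigma>" by (rule prob_space_normal_measure) fact
  obtain A B where AB: "\<And>x u. \<bar>f (x + u) - f x - A x * u - B x * u\<^sup>2\<bar> \<le> K * \<bar>u\<bar> ^ 3"
    using f unfolding cubic_expansion_def by blast
  have K: "0 \<le> K" using AB[of 0 1] by (simp add: order_trans[OF abs_ge_zero])
  define R where "R u = f (x + u) - f x - A x * u - B x * u\<^sup>2" for u
  have R: "\<bar>R u\<bar> \<le> K * \<bar>u\<bar> ^ 3" for u unfolding R_def by (rule AB)
  note mom = normal_measure_moments[OF \<sigma>(1)]
  note [simp] = mom[THEN integrable.intros] mom(1,2)[THEN has_bochner_integral_integral_eq]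
  have [simp]: "integrable (normal_measure \<sigma>) (\<lambda>z. f (x + z))"
    by (rule integrable_cubic_expansion) fact+
  have intR: "integrable (normal_measure \<sigma>) R" unfolding R_def by auto
  have "(\<integral>z. R z \<partial>normal_measure \<sigma>) = (\<integral>z. f (x + z) \<partial>normal_measure \<sigma>) - f x - B x * \<sigma>\<^sup>2"
    unfolding R_def using prob_space by simp
  \<comment> \<open>The centred two-point law kills the term with \<open>A\<close>, and its variance
    is \<open>\<sigma>\<^sup>2\<close>. The term with \<open>B\<close> is therefore the same as in
    the Gaussian integral and cancels.\<close>
  moreover have "bernoulli_step p \<delta> f x - f x - B x * \<sigma>\<^sup>2 =
      p * R (\<delta> * (1 - p)) + (1 - p) * R (- (\<delta> * p))"
    unfolding R_def bernoulli_step_def \<sigma>(2) by (simp add: power2_eq_square algebra_simps)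
  ultimately have eq: "bernoulli_step p \<delta> f x - (\<integral>z. f (x + z) \<partial>normal_measure \<sigma>) =
      p * R (\<delta> * (1 - p)) + (1 - p) * R (- (\<delta> * p)) - (\<integral>z. R z \<partial>normal_measure \<sigma>)"
    by simp
  \<comment> \<open>The constant 3 is 1 + 2: both Bernoulli increments have absolute value at most
    \<open>\<delta>\<close>, which gives one \<open>K * \<delta> ^ 3\<close>, and the Gaussian third
    moment together with \<open>\<sigma> \<le> \<delta>\<close> gives two more.\<close>
  have Rsmall: "\<bar>R u\<bar> \<le> K * \<delta> ^ 3" if "\<bar>u\<bar> \<le> \<delta>" for u
    by (rule order_trans[OF R]) (use that K in \<open>auto intro!: mult_left_mono power_mono\<close>)
  have "\<bar>p * R (\<delta> * (1 - p)) + (1 - p) * R (- (\<delta> * p))\<bar> \<le>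
      p * \<bar>R (\<delta> * (1 - p))\<bar> + (1 - p) * \<bar>R (- (\<delta> * p))\<bar>"
    using p by (intro order_trans[OF abs_triangle_ineq] add_mono) (auto simp: abs_mult)
  also have "\<dots> \<le> p * (K * \<delta> ^ 3) + (1 - p) * (K * \<delta> ^ 3)"
    using p \<delta> by (intro add_mono mult_left_mono Rsmall) (auto simp: abs_mult mult_le_cancel_left1)
  finally have 1: "\<bar>p * R (\<delta> * (1 - p)) + (1 - p) * R (- (\<delta> * p))\<bar> \<le> K * \<delta> ^ 3"
    by (simp add: algebra_simps)
  have "\<bar>\<integral>z. R z \<partial>normal_measure \<sigma>\<bar> \<le> (\<integral>z. \<bar>R z\<bar> \<partial>normal_measure \<sigma>)"
    by (rule integral_abs_bound)
  also have "\<dots> \<le> (\<integral>z. K * \<bar>z\<bar> ^ 3 \<partial>normal_measure \<sigma>)"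
    using intR R by (intro integral_mono) auto
  also have "\<dots> \<le> K * (2 * \<sigma> ^ 3)"
    using normal_measure_moment3_le[OF \<sigma>(1)] K by (auto intro!: mult_left_mono)
  also have "\<dots> \<le> K * (2 * \<delta> ^ 3)"
  proof -
    have "p * (1 - p) \<le> 1 * 1" using p by (intro mult_mono) auto
    then have "\<sigma>\<^sup>2 \<le> \<delta>\<^sup>2 * 1" unfolding \<sigma>(2) by (intro mult_left_mono) auto
    then have "\<sigma> \<le> \<delta>" using \<delta> power2_le_imp_le[of \<sigma> \<delta>] by simp
    then show ?thesis using \<sigma> K by (intro mult_left_mono power_mono) auto
  qed
  finally have 2: "\<bar>\<integral>z. R z \<partial>normal_measure \<sigma>\<bar> \<le> 2 * (K * \<delta> ^ 3)" by simp
  show ?thesis unfolding eq using 1 2 by linarith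
qed

text \<open>Induction on the number of steps, for all \<open>f\<close> and \<open>x\<close> at once.
  One trial is absorbed into the function, the induction hypothesis for
  \<open>bernoulli_step p \<delta> f\<close> makes the other steps Gaussian, and the absorbed step
  is then exchanged under the Gaussian integral, uniformly in the base point. Counting from
  \<open>Suc n\<close> keeps the variance positive, since \<open>normal_measure 0\<close> is not a
  point mass.\<close>

lemma lindeberg_binomial_normal:
  assumes "cubic_expansion K f" "f \<in> borel_measurable borel"
    and p: "0 < p" "p < 1" and \<delta>: "\<delta> > 0"
  shows "\<bar>measure_pmf.expectation (binomial_pmf (Suc n) p) (\<lambda>k. f (x + \<delta> * (real k - real (Suc n) * p))) -
    (\<integral>z. f (x + z) \<partial>normal_measure (sqrt (real (Suc n) * (\<delta>\<^sup>2 * (p * (1 - p))))))\<bar>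
    \<le> real (Suc n) * (3 * K * \<delta> ^ 3)"
  using assms(1,2)
proof (induction n arbitrary: f x)
  case 0
  define \<sigma> where "\<sigma> = sqrt (\<delta>\<^sup>2 * (p * (1 - p)))"
  have \<sigma>: "\<sigma> > 0" "\<sigma>\<^sup>2 = \<delta>\<^sup>2 * (p * (1 - p))" using p \<delta> by (auto simp: \<sigma>_def)
  have "measure_pmf.expectation (binomial_pmf (Suc 0) p) (\<lambda>k. f (x + \<delta> * (real k - real (Suc 0) * p))) =
      bernoulli_step p \<delta> f x"
    using p by (subst expectation_binomial_pmf_Suc) (auto simp: bernoulli_step_def binomial_pmf_0)
  then show ?case
    using bernoulli_step_normal[OF 0 p \<delta> \<sigma>, of x] by (simp add: \<sigma>_def)
next
  case (Suc n)
  note [measurable] = Suc.prems(2)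
  define v where "v = \<delta>\<^sup>2 * (p * (1 - p))"
  define \<sigma> where "\<sigma> = sqrt v"
  define \<rho> where "\<rho> = sqrt (real (Suc n) * v)"
  define \<rho>' where "\<rho>' = sqrt (real (Suc (Suc n)) * v)"
  have v: "v > 0" using p \<delta> by (auto simp: v_def)
  have \<sigma>: "\<sigma> > 0" "\<sigma>\<^sup>2 = \<delta>\<^sup>2 * (p * (1 - p))" using v by (auto simp: \<sigma>_def v_def)
  have \<rho>: "\<rho> > 0" "\<rho>' > 0" using v by (auto simp: \<rho>_def \<rho>'_def)
  have sq: "sqrt (\<rho>\<^sup>2 + \<sigma>\<^sup>2) = \<rho>'" using v by (simp add: \<rho>_def \<sigma>_def \<rho>'_def algebra_simps)
  let ?T = "bernoulli_step p \<delta> f" and ?G = "\<lambda>x. \<integral>z. f (x + z) \<partial>normal_measure \<sigma>"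
  interpret prob_space "normal_measure \<rho>" by (rule prob_space_normal_measure) fact
  interpret S: prob_space "normal_measure \<sigma>" by (rule prob_space_normal_measure) fact
  have T: "cubic_expansion K ?T" "?T \<in> borel_measurable borel"
    using Suc.prems p by (auto intro: cubic_expansion_bernoulli_step)
  have TG: "\<bar>?T y - ?G y\<bar> \<le> 3 * K * \<delta> ^ 3" for y
    by (rule bernoulli_step_normal[OF Suc.prems p \<delta> \<sigma>])
  \<comment> \<open>Taking one trial out moves \<open>p\<close> from the centring into the step: a
    success shifts the argument by \<open>\<delta> * (1 - p)\<close>, a failure by
    \<open>- \<delta> * p\<close>.\<close>
  have E: "measure_pmf.expectation (binomial_pmf (Suc (Suc n)) p) (\<lambda>k. f (x + \<delta> * (real k - real (Suc (Suc n)) * p)))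
      = measure_pmf.expectation (binomial_pmf (Suc n) p) (\<lambda>k. ?T (x + \<delta> * (real k - real (Suc n) * p)))"
    using p by (subst expectation_binomial_pmf_Suc) (auto simp: bernoulli_step_def algebra_simps)
  have "(\<integral>z. f (x + z) \<partial>normal_measure \<rho>') = (\<integral>z. ?G (x + z) \<partial>normal_measure \<rho>)"
    using integral_normal_measure_add[of "\<lambda>z. f (x + z)" \<rho> \<sigma>] \<rho> \<sigma>(1) Suc.prems
      integrable_cubic_expansion[OF Suc.prems \<rho>(2), of x] by (simp add: sq add.assoc)
  moreover have iT: "integrable (normal_measure \<rho>) (\<lambda>z. ?T (x + z))"
    by (rule integrable_cubic_expansion[OF T \<rho>(1)])
  \<comment> \<open>This difference is bounded and measurable. Subtracting it from the integrable
    \<open>?T\<close> also gives the integrability of \<open>?G\<close>.\<close>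
  moreover have iTG: "integrable (normal_measure \<rho>) (\<lambda>z. ?T (x + z) - ?G (x + z))"
    by (rule integrable_const_bound[of _ "3 * K * \<delta> ^ 3"])
       (use TG in \<open>auto intro!: borel_measurable_diff S.borel_measurable_lebesgue_integral\<close>)
  ultimately have "(\<integral>z. ?T (x + z) \<partial>normal_measure \<rho>) - (\<integral>z. f (x + z) \<partial>normal_measure \<rho>') =
      (\<integral>z. ?T (x + z) - ?G (x + z) \<partial>normal_measure \<rho>)"
    using Bochner_Integration.integrable_diff[OF iT iTG] by (subst Bochner_Integration.integral_diff) auto
  also have "\<bar>\<dots>\<bar> \<le> (\<integral>z. \<bar>?T (x + z) - ?G (x + z)\<bar> \<partial>normal_measure \<rho>)"
    by (rule integral_abs_bound)
  also have "\<dots> \<le> 3 * K * \<delta> ^ 3"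
    by (rule integral_le_const[OF integrable_abs[OF iTG]]) (simp add: TG)
  finally have 1: "\<bar>(\<integral>z. ?T (x + z) \<partial>normal_measure \<rho>) - (\<integral>z. f (x + z) \<partial>normal_measure \<rho>')\<bar>
    \<le> 3 * K * \<delta> ^ 3" .
  have "real (Suc (Suc n)) * (3 * K * \<delta> ^ 3) = real (Suc n) * (3 * K * \<delta> ^ 3) + 3 * K * \<delta> ^ 3"
    by (simp add: algebra_simps)
  then show ?case
    using Suc.IH[OF T, of x] 1 unfolding E v_def[symmetric] \<rho>_def[symmetric] \<rho>'_def[symmetric]
    by linarith
qed

subsection \<open>Test functions along a line\<close>

lemma mvt_abs:
  fixes \<phi> :: "real \<Rightarrow> real"
  assumes "\<And>t. (\<phi> has_real_derivative \<phi>' t) (at t)"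
  obtains t where "\<bar>t - a\<bar> \<le> \<bar>b - a\<bar>" "\<phi> b - \<phi> a = \<phi>' t * (b - a)"
proof (cases a b rule: linorder_cases)
  case less
  then obtain t where "a < t" "t < b" "\<phi> b - \<phi> a = (b - a) * \<phi>' t"
    using MVT2[OF less, of \<phi> \<phi>'] assms by auto
  then show ?thesis by (intro that[of t]) auto
next
  case equal
  then show ?thesis by (intro that[of a]) auto
next
  case greater
  then obtain t where "b < t" "t < a" "\<phi> a - \<phi> b = (a - b) * \<phi>' t"
    using MVT2[OF greater, of \<phi> \<phi>'] assms by auto
  then show ?thesis by (intro that[of t]) (auto simp: algebra_simps)
qed

text \<open>Replaces the chain rule along a line: test functions are only known to have derivatives
  in coordinate directions, whereas a quadratic estimate can be restricted to any line.\<close>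

lemma has_real_derivative_of_quadratic_bound:
  fixes \<phi> :: "real \<Rightarrow> real"
  assumes "\<And>s. \<bar>\<phi> s - \<phi> t - a * (s - t)\<bar> \<le> K * (s - t)\<^sup>2"
  shows "(\<phi> has_real_derivative a) (at t)"
proof -
  have "((\<lambda>s. (\<phi> s - \<phi> t) / (s - t) - a) \<longlongrightarrow> 0) (at t)"
  proof (rule Lim_null_comparison)
    show "\<forall>\<^sub>F s in at t. norm ((\<phi> s - \<phi> t) / (s - t) - a) \<le> K * \<bar>s - t\<bar>"
      unfolding eventually_at
    proof (intro exI[of _ 1] conjI ballI impI)
      fix s assume s: "s \<noteq> t \<and> dist s t < 1"
      then have "\<bar>(\<phi> s - \<phi> t) / (s - t) - a\<bar> = \<bar>\<phi> s - \<phi> t - a * (s - t)\<bar> / \<bar>s - t\<bar>"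
        by (simp add: abs_divide[symmetric] diff_divide_distrib)
      also have "\<dots> \<le> K * (s - t)\<^sup>2 / \<bar>s - t\<bar>"
        by (intro divide_right_mono assms) auto
      also have "\<dots> = K * \<bar>s - t\<bar>"
        using s by (simp add: power2_eq_square abs_if field_simps)
      finally show "norm ((\<phi> s - \<phi> t) / (s - t) - a) \<le> K * \<bar>s - t\<bar>" by simp
    qed simp
    show "((\<lambda>s. K * \<bar>s - t\<bar>) \<longlongrightarrow> 0) (at t)"
      by (auto intro!: tendsto_eq_intros)
  qed
  then show ?thesis
    by (simp add: has_field_derivative_iff LIM_zero_iff)
qed

text \<open>Walk from \<open>x\<close> to \<open>y\<close> along edges parallel to the axes,
  changing one coordinate at a time, apply the mean value theorem on each edge and telescope. Each
  edge has its own intermediate point, no coordinate of which is farther from \<open>x\<close> than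
  that of \<open>y\<close>.\<close>

lemma coordinatewise_mvt:
  fixes F :: "(nat \<Rightarrow> real) \<Rightarrow> real" and D :: "nat \<Rightarrow> (nat \<Rightarrow> real) \<Rightarrow> real"
  assumes der: "\<And>i x. i < r \<Longrightarrow> x \<in> {..<r} \<rightarrow>\<^sub>E UNIV \<Longrightarrow>
      ((\<lambda>t. F (x(i := t))) has_real_derivative D i x) (at (x i))"
    and x: "x \<in> {..<r} \<rightarrow>\<^sub>E UNIV" and y: "y \<in> {..<r} \<rightarrow>\<^sub>E UNIV"
  obtains \<xi> where "\<And>i. i < r \<Longrightarrow> \<xi> i \<in> {..<r} \<rightarrow>\<^sub>E UNIV"
    and "\<And>i j. i < r \<Longrightarrow> \<bar>\<xi> i j - x j\<bar> \<le> \<bar>y j - x j\<bar>"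
    and "F y - F x = (\<Sum>i<r. D i (\<xi> i) * (y i - x i))"
proof -
  define P where "P k = (\<lambda>i. if i < k then y i else x i)" for k
  have PE: "(P k)(i := t) \<in> {..<r} \<rightarrow>\<^sub>E UNIV" if "i < r" for k i t
    using x y that by (auto simp: P_def PiE_def extensional_def)
  have P0: "P 0 = x" by (auto simp: P_def)
  have Pr: "P r = y" using x y by (auto simp: P_def PiE_def extensional_def)
  have ex: "\<exists>t. \<bar>t - x i\<bar> \<le> \<bar>y i - x i\<bar> \<and> F (P (Suc i)) - F (P i) = D i ((P i)(i := t)) * (y i - x i)"
    if i: "i < r" for i
  proof -
    \<comment> \<open>\<open>der\<close> differentiates only at the current coordinate of its point.
      Applied to \<open>(P i)(i := t)\<close>, it yields the derivative at every \<open>t\<close> of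
      the edge.\<close>
    have "((\<lambda>t. F ((P i)(i := t))) has_real_derivative D i ((P i)(i := t))) (at t)" for t
      using der[OF i PE[OF i, of i t]] by simp
    from mvt_abs[of "\<lambda>t. F ((P i)(i := t))", OF this, of "x i" "y i"]
    obtain t where t: "\<bar>t - x i\<bar> \<le> \<bar>y i - x i\<bar>"
      "F ((P i)(i := y i)) - F ((P i)(i := x i)) = D i ((P i)(i := t)) * (y i - x i)" by blast
    moreover have "(P i)(i := y i) = P (Suc i)" "(P i)(i := x i) = P i"
      by (auto simp: P_def less_Suc_eq)
    ultimately show ?thesis by auto
  qed
  define T where "T i = (SOME t. \<bar>t - x i\<bar> \<le> \<bar>y i - x i\<bar> \<and>
      F (P (Suc i)) - F (P i) = D i ((P i)(i := t)) * (y i - x i))" for i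
  have T: "\<bar>T i - x i\<bar> \<le> \<bar>y i - x i\<bar>"
      "F (P (Suc i)) - F (P i) = D i ((P i)(i := T i)) * (y i - x i)" if "i < r" for i
    using someI_ex[OF ex[OF that]] unfolding T_def by auto
  show ?thesis
  proof (rule that[of "\<lambda>i. (P i)(i := T i)"])
    show "(P i)(i := T i) \<in> {..<r} \<rightarrow>\<^sub>E UNIV" if "i < r" for i by (rule PE[OF that])
    show "\<bar>((P i)(i := T i)) j - x j\<bar> \<le> \<bar>y j - x j\<bar>" if "i < r" for i j
      using T(1)[OF that] by (auto simp: P_def)
    have "F y - F x = (\<Sum>i<r. F (P (Suc i)) - F (P i))"
      by (subst sum_lessThan_telescope) (simp add: P0 Pr)
    also have "\<dots> = (\<Sum>i<r. D i ((P i)(i := T i)) * (y i - x i))"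
      by (intro sum.cong refl T(2)) auto
    finally show "F y - F x = (\<Sum>i<r. D i ((P i)(i := T i)) * (y i - x i))" .
  qed
qed

lemma lipschitz_of_bounded_partials:
  fixes F :: "(nat \<Rightarrow> real) \<Rightarrow> real"
  assumes der: "\<And>i x. i < r \<Longrightarrow> x \<in> {..<r} \<rightarrow>\<^sub>E UNIV \<Longrightarrow>
      ((\<lambda>t. F (x(i := t))) has_real_derivative D i x) (at (x i))"
    and bound: "\<And>i x. i < r \<Longrightarrow> x \<in> {..<r} \<rightarrow>\<^sub>E UNIV \<Longrightarrow> \<bar>D i x\<bar> \<le> 1"
    and x: "x \<in> {..<r} \<rightarrow>\<^sub>E UNIV" and y: "y \<in> {..<r} \<rightarrow>\<^sub>E UNIV"
  shows "\<bar>F y - F x\<bar> \<le> (\<Sum>i<r. \<bar>y i - x i\<bar>)"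
proof -
  obtain \<xi> where \<xi>: "\<And>i. i < r \<Longrightarrow> \<xi> i \<in> {..<r} \<rightarrow>\<^sub>E UNIV"
    and eq: "F y - F x = (\<Sum>i<r. D i (\<xi> i) * (y i - x i))"
    by (rule coordinatewise_mvt[of r F D x y, OF der x y]) blast+
  have "\<bar>F y - F x\<bar> \<le> (\<Sum>i<r. \<bar>D i (\<xi> i) * (y i - x i)\<bar>)" unfolding eq by (rule sum_abs)
  also have "\<dots> \<le> (\<Sum>i<r. \<bar>y i - x i\<bar>)"
    using bound \<xi> by (intro sum_mono) (simp add: abs_mult mult_left_le_one_le)
  finally show ?thesis .
qed

text \<open>Moving each derivative of \<open>coordinatewise_mvt\<close> from its intermediate point
  back to \<open>x\<close> costs one more factor of the l1-distance. This gives the square, with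
  constant 1 in place of Taylor's 1/2.\<close>

lemma quadratic_bound_of_lipschitz_partials:
  fixes F :: "(nat \<Rightarrow> real) \<Rightarrow> real"
  assumes der: "\<And>i x. i < r \<Longrightarrow> x \<in> {..<r} \<rightarrow>\<^sub>E UNIV \<Longrightarrow>
      ((\<lambda>t. F (x(i := t))) has_real_derivative D i x) (at (x i))"
    and lip: "\<And>i x y. i < r \<Longrightarrow> x \<in> {..<r} \<rightarrow>\<^sub>E UNIV \<Longrightarrow> y \<in> {..<r} \<rightarrow>\<^sub>E UNIV \<Longrightarrow>
      \<bar>D i y - D i x\<bar> \<le> (\<Sum>j<r. \<bar>y j - x j\<bar>)"
    and x: "x \<in> {..<r} \<rightarrow>\<^sub>E UNIV" and y: "y \<in> {..<r} \<rightarrow>\<^sub>E UNIV"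
  shows "\<bar>F y - F x - (\<Sum>i<r. D i x * (y i - x i))\<bar> \<le> (\<Sum>i<r. \<bar>y i - x i\<bar>)\<^sup>2"
proof -
  obtain \<xi> where \<xi>: "\<And>i. i < r \<Longrightarrow> \<xi> i \<in> {..<r} \<rightarrow>\<^sub>E UNIV"
      "\<And>i j. i < r \<Longrightarrow> \<bar>\<xi> i j - x j\<bar> \<le> \<bar>y j - x j\<bar>"
    and eq: "F y - F x = (\<Sum>i<r. D i (\<xi> i) * (y i - x i))"
    by (rule coordinatewise_mvt[of r F D x y, OF der x y]) blast+
  have "\<bar>F y - F x - (\<Sum>i<r. D i x * (y i - x i))\<bar> = \<bar>\<Sum>i<r. (D i (\<xi> i) - D i x) * (y i - x i)\<bar>"
    unfolding eq by (simp add: sum_subtractf left_diff_distrib)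
  also have "\<dots> \<le> (\<Sum>i<r. \<bar>D i (\<xi> i) - D i x\<bar> * \<bar>y i - x i\<bar>)"
    by (rule order_trans[OF sum_abs]) (simp add: abs_mult)
  also have "\<dots> \<le> (\<Sum>i<r. (\<Sum>j<r. \<bar>y j - x j\<bar>) * \<bar>y i - x i\<bar>)"
  proof (intro sum_mono mult_right_mono)
    fix i assume "i \<in> {..<r}"
    then have i: "i < r" by simp
    have "\<bar>D i (\<xi> i) - D i x\<bar> \<le> (\<Sum>j<r. \<bar>\<xi> i j - x j\<bar>)" by (rule lip[OF i x \<xi>(1)[OF i]])
    also have "\<dots> \<le> (\<Sum>j<r. \<bar>y j - x j\<bar>)" by (intro sum_mono \<xi>(2) i)
    finally show "\<bar>D i (\<xi> i) - D i x\<bar> \<le> (\<Sum>j<r. \<bar>y j - x j\<bar>)" .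
  qed auto
  finally show ?thesis by (simp add: sum_distrib_left power2_eq_square)
qed

text \<open>Composed with restriction to \<open>{..<r}\<close>, \<open>F\<close> is continuous on
  the space of all functions \<open>nat \<Rightarrow> real\<close> with the product topology, whose
  Borel sets form the product sigma-algebra. \<open>Rvec r\<close> is embedded there by padding with
  zeros, and restriction undoes the padding.\<close>

lemma borel_measurable_lipschitz_Rvec:
  fixes F :: "(nat \<Rightarrow> real) \<Rightarrow> real"
  assumes lip: "\<And>x y. x \<in> {..<r} \<rightarrow>\<^sub>E UNIV \<Longrightarrow> y \<in> {..<r} \<rightarrow>\<^sub>E UNIV \<Longrightarrow>
      \<bar>F y - F x\<bar> \<le> (\<Sum>i<r. \<bar>y i - x i\<bar>)"
  shows "F \<in> borel_measurable (Rvec r)"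
proof -
  define R where "R x = (\<lambda>i\<in>{..<r}. x i)" for x :: "nat \<Rightarrow> real"
  define e where "e x = (\<lambda>i. if i < r then x i else 0)" for x :: "nat \<Rightarrow> real"
  have "isCont (\<lambda>x. F (R x)) x" for x
    unfolding isCont_def
  proof (rule LIM_zero_cancel)
    show "((\<lambda>y. F (R y) - F (R x)) \<longlongrightarrow> 0) (at x)"
    proof (rule Lim_null_comparison)
      show "\<forall>\<^sub>F y in at x. norm (F (R y) - F (R x)) \<le> (\<Sum>i<r. \<bar>y i - x i\<bar>)"
        using lip[of "R _" "R _"] by (intro always_eventually) (auto simp: R_def)
      have "((\<lambda>y. y i) \<longlongrightarrow> x i) (at x)" for i
        using continuous_on_product_coordinates[of i] by (auto simp: continuous_on_def)
      then have "((\<lambda>y. \<Sum>i<r. \<bar>y i - x i\<bar>) \<longlongrightarrow> (\<Sum>i<r. \<bar>x i - x i\<bar>)) (at x)"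
        by (intro tendsto_intros)
      then show "((\<lambda>y. \<Sum>i<r. \<bar>y i - x i\<bar>) \<longlongrightarrow> 0) (at x)" by simp
    qed
  qed
  then have "(\<lambda>x. F (R x)) \<in> borel_measurable borel"
    by (intro borel_measurable_continuous_onI) (simp add: continuous_at_imp_continuous_on)
  moreover have "e \<in> Rvec r \<rightarrow>\<^sub>M borel"
  proof -
    have "e \<in> Rvec r \<rightarrow>\<^sub>M Pi\<^sub>M UNIV (\<lambda>_. borel)"
      unfolding Rvec_def e_def
    proof (rule measurable_PiM_single')
      show "(\<lambda>x. if i < r then x i else 0) \<in> borel_measurable (Pi\<^sub>M {..<r} (\<lambda>_. borel))" for i
        by (cases "i < r") (auto intro!: measurable_component_singleton)
    qed auto
    then show ?thesis using measurable_cong_sets[OF refl sets_PiM_equal_borel] by blast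
  qed
  ultimately have "(\<lambda>x. F (R (e x))) \<in> borel_measurable (Rvec r)"
    by (rule measurable_compose[rotated])
  moreover have "R (e x) = x" if "x \<in> space (Rvec r)" for x
    using that by (auto simp: R_def e_def Rvec_def space_PiM PiE_def extensional_def)
  ultimately show ?thesis by (simp cong: measurable_cong)
qed

section \<open>Regularity of test functions and their restriction to a line\<close>

lemma iter_partial_has_derivative:
  assumes "partially_differentiable r k g" "length is < k" "set is \<subseteq> {..<r}" "i < r"
    "x \<in> {..<r} \<rightarrow>\<^sub>E UNIV"
  shows "((\<lambda>t. iter_partial is g (x(i := t))) has_real_derivative iter_partial (i # is) g x) (at (x i))"
proof -
  have "(\<lambda>t. iter_partial is g (x(i := t))) differentiable (at (x i))"
    using assms unfolding partially_differentiable_def by blast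
  then show ?thesis
    by (simp add: DERIV_deriv_iff_real_differentiable iter_partial_def partial_deriv_def)
qed

lemma iter_partial_le_M_norm:
  assumes "M_norm r k g \<le> 1" "set is \<subseteq> {..<r}" "length is = k" "x \<in> {..<r} \<rightarrow>\<^sub>E UNIV"
  shows "\<bar>iter_partial is g x\<bar> \<le> 1"
proof -
  have "ereal \<bar>iter_partial is g x\<bar> \<le> (SUP x \<in> {..<r} \<rightarrow>\<^sub>E UNIV. ereal \<bar>iter_partial is g x\<bar>)"
    using assms by (intro SUP_upper)
  also have "\<dots> \<le> M_norm r k g"
    unfolding M_norm_def using assms
    by (intro Max_ge finite_imageI finite_lists_length_eq imageI) auto
  also have "\<dots> \<le> 1" by fact
  finally show ?thesis by simp
qed

text \<open>A bound on the partials of the next order is a Lipschitz bound in the l1-distance. Lists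
  of length 0, 1 and 2 use the bounds on \<open>M_norm\<close> of orders 1, 2 and 3.\<close>

lemma d4_test_function_lipschitz:
  assumes g: "g \<in> d4_test_functions r" and "is": "set is \<subseteq> {..<r}" "length is \<le> 2"
    and "x \<in> {..<r} \<rightarrow>\<^sub>E UNIV" "y \<in> {..<r} \<rightarrow>\<^sub>E UNIV"
  shows "\<bar>iter_partial is g y - iter_partial is g x\<bar> \<le> (\<Sum>i<r. \<bar>y i - x i\<bar>)"
proof (rule lipschitz_of_bounded_partials[where D = "\<lambda>i. iter_partial (i # is) g"])
  fix i z assume iz: "i < r" "z \<in> {..<r} \<rightarrow>\<^sub>E (UNIV :: real set)"
  show "((\<lambda>t. iter_partial is g (z(i := t))) has_real_derivative iter_partial (i # is) g z) (at (z i))"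
    using g "is" iz by (intro iter_partial_has_derivative[of r 4]) (auto simp: d4_test_functions_def)
  have "length is = 0 \<or> length is = 1 \<or> length is = 2" using "is"(2) by linarith
  then have "M_norm r (Suc (length is)) g \<le> 1"
    using g by (auto simp: d4_test_functions_def eval_nat_numeral)
  then show "\<bar>iter_partial (i # is) g z\<bar> \<le> 1"
    by (rule iter_partial_le_M_norm) (use "is" iz in auto)
qed fact+

lemma d4_test_function_quadratic:
  assumes g: "g \<in> d4_test_functions r" and "is": "set is \<subseteq> {..<r}" "length is \<le> 1"
    and "x \<in> {..<r} \<rightarrow>\<^sub>E UNIV" "y \<in> {..<r} \<rightarrow>\<^sub>E UNIV"
  shows "\<bar>iter_partial is g y - iter_partial is g x - (\<Sum>i<r. iter_partial (i # is) g x * (y i - x i))\<bar>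
    \<le> (\<Sum>i<r. \<bar>y i - x i\<bar>)\<^sup>2"
proof (rule quadratic_bound_of_lipschitz_partials[where D = "\<lambda>i. iter_partial (i # is) g"])
  fix i z assume iz: "i < r" "z \<in> {..<r} \<rightarrow>\<^sub>E (UNIV :: real set)"
  show "((\<lambda>t. iter_partial is g (z(i := t))) has_real_derivative iter_partial (i # is) g z) (at (z i))"
    using g "is" iz by (intro iter_partial_has_derivative[of r 4]) (auto simp: d4_test_functions_def)
  fix w assume w: "w \<in> {..<r} \<rightarrow>\<^sub>E (UNIV :: real set)"
  show "\<bar>iter_partial (i # is) g w - iter_partial (i # is) g z\<bar> \<le> (\<Sum>j<r. \<bar>w j - z j\<bar>)"
    by (rule d4_test_function_lipschitz[OF g]) (use "is" iz w in auto)
qed fact+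

text \<open>Measurability is not part of the definition of a test function; it comes from the bound
  on the first partials.\<close>

lemma borel_measurable_d4_test_function:
  assumes "g \<in> d4_test_functions r"
  shows "g \<in> borel_measurable (Rvec r)"
  using d4_test_function_lipschitz[OF assms, of "[]"]
  by (intro borel_measurable_lipschitz_Rvec) (simp add: iter_partial_def)

definition line :: "nat \<Rightarrow> (nat \<Rightarrow> real) \<Rightarrow> real \<Rightarrow> nat \<Rightarrow> real" where
  "line r c t = (\<lambda>i\<in>{..<r}. c i * t)"

lemma line_in_PiE [simp]: "line r c t \<in> {..<r} \<rightarrow>\<^sub>E UNIV"
  by (simp add: line_def)

lemma line_measurable [measurable]: "line r c \<in> borel \<rightarrow>\<^sub>M Rvec r"
  unfolding line_def[abs_def] Rvec_def by measurable

text \<open>The quadratic estimate for \<open>g\<close> identifies the derivative of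
  \<open>h\<close> as \<open>h1\<close>, and the same estimate for the first partials expands
  \<open>h1\<close> to first order with slope \<open>h2\<close>. One mean value step turns the error
  of \<open>h1\<close> into a cubic error of \<open>h\<close>. Each of the three orders contributes
  a factor \<open>C\<close>, the l1-norm of the direction \<open>c\<close>.\<close>

lemma cubic_expansion_line:
  assumes g: "g \<in> d4_test_functions r"
  shows "cubic_expansion ((\<Sum>i<r. \<bar>c i\<bar>) ^ 3) (\<lambda>t. g (line r c t))"
proof -
  define C where "C = (\<Sum>i<r. \<bar>c i\<bar>)"
  have C: "C \<ge> 0" by (auto simp: C_def sum_nonneg)
  define h where "h t = g (line r c t)" for t
  define h1 where "h1 t = (\<Sum>i<r. c i * iter_partial [i] g (line r c t))" for t
  define h2 where "h2 t = (\<Sum>i<r. c i * (\<Sum>j<r. c j * iter_partial [j, i] g (line r c t)))" for t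
  have diff: "(\<Sum>i<r. \<bar>line r c s i - line r c t i\<bar>) = C * \<bar>s - t\<bar>" for s t
    unfolding C_def sum_distrib_right
    by (intro sum.cong) (auto simp: line_def abs_mult[symmetric] right_diff_distrib)
  have quad: "\<bar>iter_partial is g (line r c s) - iter_partial is g (line r c t)
      - (\<Sum>i<r. c i * iter_partial (i # is) g (line r c t)) * (s - t)\<bar> \<le> C\<^sup>2 * (s - t)\<^sup>2"
    if "set is \<subseteq> {..<r}" "length is \<le> 1" for "is" s t
  proof -
    have "(\<Sum>i<r. c i * iter_partial (i # is) g (line r c t)) * (s - t) =
        (\<Sum>i<r. iter_partial (i # is) g (line r c t) * (line r c s i - line r c t i))"
      unfolding sum_distrib_right by (intro sum.cong) (auto simp: line_def right_diff_distrib)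
    then show ?thesis
      using d4_test_function_quadratic[OF g that, of "line r c t" "line r c s"]
      by (simp add: diff power_mult_distrib)
  qed
  have der: "(h has_real_derivative h1 t) (at t)" for t
    using quad[of "[]" _ t]
    by (intro has_real_derivative_of_quadratic_bound[where K = "C\<^sup>2"])
       (simp add: h_def h1_def iter_partial_def)
  have h1: "\<bar>h1 s - h1 t - h2 t * (s - t)\<bar> \<le> C ^ 3 * (s - t)\<^sup>2" for s t
  proof -
    have eq: "h1 s - h1 t - h2 t * (s - t) = (\<Sum>i<r. c i * (iter_partial [i] g (line r c s)
        - iter_partial [i] g (line r c t) - (\<Sum>j<r. c j * iter_partial [j, i] g (line r c t)) * (s - t)))"
      by (simp add: h1_def h2_def right_diff_distrib sum_subtractf sum_distrib_right mult.assoc)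
    have "\<bar>h1 s - h1 t - h2 t * (s - t)\<bar> \<le> (\<Sum>i<r. \<bar>c i\<bar> * (C\<^sup>2 * (s - t)\<^sup>2))"
      unfolding eq
      by (intro order_trans[OF sum_abs] sum_mono) (auto simp: abs_mult intro!: mult_left_mono quad)
    also have "\<dots> = C ^ 3 * (s - t)\<^sup>2"
      by (subst sum_distrib_right[symmetric], subst C_def[symmetric])
         (simp only: power3_eq_cube power2_eq_square mult.assoc)
    finally show ?thesis .
  qed
  have "\<bar>h (x + u) - h x - h1 x * u - h2 x / 2 * u\<^sup>2\<bar> \<le> C ^ 3 * \<bar>u\<bar> ^ 3" for x u
  proof -
    \<comment> \<open>\<open>\<phi>\<close> is the remainder as a function of the increment. It
      vanishes at 0, and its derivative is the first-order remainder of \<open>h1\<close> at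
      \<open>x\<close>.\<close>
    define \<phi> where "\<phi> v = h (x + v) - h x - h1 x * v - h2 x / 2 * v\<^sup>2" for v
    have "(\<phi> has_real_derivative h1 (x + v) - h1 x - h2 x * v) (at v)" for v
    proof -
      have "((\<lambda>v. h (x + v)) has_real_derivative h1 (x + v)) (at v)"
        using DERIV_shift[of h "h1 (v + x)" v x] der[of "v + x"] by (simp add: add.commute)
      from DERIV_diff[OF DERIV_diff[OF DERIV_diff[OF this DERIV_const[of "h x"]]
          DERIV_cmult[OF DERIV_ident, of "h1 x"]] DERIV_cmult[OF DERIV_pow[of 2], of "h2 x / 2"]]
      show ?thesis by (simp add: \<phi>_def[abs_def])
    qed
    from mvt_abs[of \<phi>, OF this, of 0 u] obtain t where t: "\<bar>t\<bar> \<le> \<bar>u\<bar>"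
      "\<phi> u = (h1 (x + t) - h1 x - h2 x * t) * u" by (auto simp: \<phi>_def)
    have "\<bar>h1 (x + t) - h1 x - h2 x * t\<bar> \<le> C ^ 3 * t\<^sup>2" using h1[of "x + t" x] by simp
    also have "\<dots> \<le> C ^ 3 * \<bar>u\<bar>\<^sup>2"
      using t(1) C by (intro mult_left_mono) (auto simp: abs_le_square_iff)
    finally have "\<bar>\<phi> u\<bar> \<le> C ^ 3 * \<bar>u\<bar>\<^sup>2 * \<bar>u\<bar>"
      unfolding t(2) abs_mult by (rule mult_right_mono) auto
    then show ?thesis by (simp add: \<phi>_def power3_eq_cube power2_eq_square mult.assoc)
  qed
  then show ?thesis unfolding cubic_expansion_def h_def C_def
    by (intro exI[of _ h1] exI[of _ "\<lambda>x. h2 x / 2"]) auto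
qed

subsection \<open>Reduction to dimension one\<close>

lemma normal_law_integrals:
  assumes "0 \<le> \<sigma>"
  shows "has_bochner_integral (normal_law m \<sigma>) (\<lambda>x. x) m"
    and "has_bochner_integral (normal_law m \<sigma>) (\<lambda>x. x\<^sup>2) (m\<^sup>2 + \<sigma>\<^sup>2)"
proof -
  have "has_bochner_integral (normal_law m \<sigma>) (\<lambda>x. x) m \<and>
    has_bochner_integral (normal_law m \<sigma>) (\<lambda>x. x\<^sup>2) (m\<^sup>2 + \<sigma>\<^sup>2)"
  proof (cases "\<sigma> = 0")
    case True
    interpret prob_space "return borel m" by (rule prob_space_return) simp
    have r: "has_bochner_integral (return borel m) f (f m)"
      if [measurable]: "f \<in> borel_measurable borel" for f :: "real \<Rightarrow> real"
    proof -
      have "AE x in return borel m. norm (f x) \<le> norm (f m)"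
        by (subst AE_return) auto
      then have "integrable (return borel m) f" by (rule integrable_const_bound) (simp add: that)
      then show ?thesis by (simp add: has_bochner_integral_iff integral_return)
    qed
    have "has_bochner_integral (return borel m) (\<lambda>x. x) m" by (rule r) measurable
    moreover have "has_bochner_integral (return borel m) (\<lambda>x. x\<^sup>2) (m\<^sup>2)" by (rule r) measurable
    ultimately show ?thesis using True by (simp add: normal_law_def)
  next
    case False
    then have \<sigma>: "\<sigma> > 0" using assms by simp
    have d: "has_bochner_integral (density lborel (normal_density m \<sigma>)) f c"
      if "has_bochner_integral lborel (\<lambda>x. normal_density m \<sigma> x * f x) c" "f \<in> borel_measurable borel"
      for f :: "real \<Rightarrow> real" and c
      using that by (intro has_bochner_integral_density) auto
    have 1: "has_bochner_integral (density lborel (normal_density m \<sigma>)) (\<lambda>x. x) m"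
      using normal_moment_nz_1[OF \<sigma>, of m] by (intro d) auto
    have 2: "has_bochner_integral (density lborel (normal_density m \<sigma>)) (\<lambda>x. (x - m)\<^sup>2) (\<sigma>\<^sup>2)"
      using normal_moment_even[OF \<sigma>, of m 1] by (intro d) auto
    interpret prob_space "density lborel (normal_density m \<sigma>)"
      by (rule prob_space_normal_density) fact
    have "has_bochner_integral (density lborel (normal_density m \<sigma>)) (\<lambda>x. m\<^sup>2) (m\<^sup>2)"
      using prob_space by (simp add: has_bochner_integral_iff)
    \<comment> \<open>Integrates the identity
      \<open>x\<^sup>2 = (x - m)\<^sup>2 + 2 * m * x - m\<^sup>2\<close>.\<close>
    from has_bochner_integral_diff[OF has_bochner_integral_add[OF 2
        has_bochner_integral_mult_right[where c = "2 * m", OF 1]] this]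
    have "has_bochner_integral (density lborel (normal_density m \<sigma>)) (\<lambda>x. x\<^sup>2) (m\<^sup>2 + \<sigma>\<^sup>2)"
      by (simp add: power2_eq_square algebra_simps)
    then show ?thesis using 1 False by (simp add: normal_law_def)
  qed
  then show "has_bochner_integral (normal_law m \<sigma>) (\<lambda>x. x) m"
    "has_bochner_integral (normal_law m \<sigma>) (\<lambda>x. x\<^sup>2) (m\<^sup>2 + \<sigma>\<^sup>2)" by auto
qed

lemma measurable_Rvec_component: "i < r \<Longrightarrow> (\<lambda>x. x i) \<in> borel_measurable (Rvec r)"
  unfolding Rvec_def by (intro measurable_component_singleton) auto

text \<open>A unit coefficient vector makes the coordinate itself normal, the zero mean forces
  \<open>m = 0\<close>, and the second moment identifies \<open>\<sigma>\<close>. Square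
  integrability is read off from the law, so the prescribed moments are not default values of
  divergent integrals.\<close>

lemma centred_gaussian_component:
  assumes \<nu>: "centred_gaussian r S \<nu>" and i: "i < r"
  obtains \<sigma> where "0 \<le> \<sigma>" "S i i = \<sigma>\<^sup>2" "distr \<nu> borel (\<lambda>x. x i) = normal_law 0 \<sigma>"
    "integrable \<nu> (\<lambda>x. (x i)\<^sup>2)"
proof -
  have [measurable_cong]: "sets \<nu> = sets (Rvec r)" using \<nu> by (simp add: centred_gaussian_def)
  note [measurable] = measurable_Rvec_component[OF i]
  have eq: "(\<Sum>k<r. (if k = i then 1 else 0) * x k) = x i" for x :: "nat \<Rightarrow> real"
    using i by (simp add: if_distrib[of "\<lambda>c. c * _"] cong: if_cong)
  have "\<forall>a. \<exists>m \<sigma>. 0 \<le> \<sigma> \<and> distr \<nu> borel (\<lambda>x. \<Sum>k<r. a k * x k) = normal_law m \<sigma>"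
    using \<nu> by (simp add: centred_gaussian_def)
  from spec[OF this, of "\<lambda>k. if k = i then 1 else 0"]
  obtain m \<sigma> where \<sigma>: "0 \<le> \<sigma>" "distr \<nu> borel (\<lambda>x. x i) = normal_law m \<sigma>"
    unfolding eq by blast
  note I = normal_law_integrals[OF \<sigma>(1), of m, folded \<sigma>(2)]
  have "(\<integral>x. x i \<partial>\<nu>) = m" "(\<integral>x. (x i)\<^sup>2 \<partial>\<nu>) = m\<^sup>2 + \<sigma>\<^sup>2"
    using I[THEN has_bochner_integral_integral_eq] by (simp_all add: integral_distr)
  moreover have "(\<integral>x. x i \<partial>\<nu>) = 0" "(\<integral>x. (x i)\<^sup>2 \<partial>\<nu>) = S i i"
    using \<nu> i by (simp_all add: centred_gaussian_def power2_eq_square)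
  moreover have "integrable \<nu> (\<lambda>x. (x i)\<^sup>2)"
    using I(2)[THEN integrable.intros] by (simp add: integrable_distr_eq)
  ultimately show ?thesis using \<sigma> by (intro that[of \<sigma>]) auto
qed

lemma integrable_mult_of_squares:
  fixes f g :: "'a \<Rightarrow> real"
  assumes "integrable M (\<lambda>x. (f x)\<^sup>2)" "integrable M (\<lambda>x. (g x)\<^sup>2)"
    and [measurable]: "f \<in> borel_measurable M" "g \<in> borel_measurable M"
  shows "integrable M (\<lambda>x. f x * g x)"
proof (rule Bochner_Integration.integrable_bound[OF Bochner_Integration.integrable_add[OF assms(1,2)]])
  have "\<bar>a * b\<bar> \<le> a\<^sup>2 + b\<^sup>2" for a b :: real
    using sum_squares_bound[of "\<bar>a\<bar>" "\<bar>b\<bar>"] by (simp add: abs_mult)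
       (use mult_nonneg_nonneg[of "\<bar>a\<bar>" "\<bar>b\<bar>"] in linarith)
  then show "AE x in M. norm (f x * g x) \<le> norm ((f x)\<^sup>2 + (g x)\<^sup>2)" by simp
qed measurable

text \<open>The three relations say that \<open>x i - c * x j\<close> has second moment
  \<open>S i i - 2 * c * S i j + c\<^sup>2 * S j j = 0\<close>.\<close>

lemma AE_component_eq_of_covariance:
  assumes \<nu>: "centred_gaussian r S \<nu>" and ij: "i < r" "j < r"
    and cov: "S i j = c * S j j" "S j i = c * S j j" "S i i = c\<^sup>2 * S j j"
  shows "AE x in \<nu>. x i = c * x j"
proof -
  have [measurable_cong]: "sets \<nu> = sets (Rvec r)" using \<nu> by (simp add: centred_gaussian_def)
  note [measurable] = measurable_Rvec_component[OF ij(1)] measurable_Rvec_component[OF ij(2)]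
  have sq: "integrable \<nu> (\<lambda>x. (x k)\<^sup>2)" if "k < r" for k
    using centred_gaussian_component[OF \<nu> that] by metis
  have int: "integrable \<nu> (\<lambda>x. x i * x j)" "integrable \<nu> (\<lambda>x. x i * x i)" "integrable \<nu> (\<lambda>x. x j * x j)"
    using ij sq by (auto intro!: integrable_mult_of_squares)
  have eq: "(x i - c * x j)\<^sup>2 = x i * x i - 2 * c * (x i * x j) + c\<^sup>2 * (x j * x j)" for x :: "nat \<Rightarrow> real"
    by (simp add: power2_eq_square algebra_simps)
  have sq_int: "integrable \<nu> (\<lambda>x. (x i - c * x j)\<^sup>2)" unfolding eq using int by auto
  have cv: "(\<integral>x. x k * x l \<partial>\<nu>) = S k l" if "k < r" "l < r" for k l
    using \<nu> that by (simp add: centred_gaussian_def)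
  have "(\<integral>x. (x i - c * x j)\<^sup>2 \<partial>\<nu>) = S i i - 2 * c * S i j + c\<^sup>2 * S j j"
    unfolding eq using int ij by (simp add: cv)
  also have "\<dots> = 0" unfolding cov by (simp add: power2_eq_square)
  finally have "AE x in \<nu>. (x i - c * x j)\<^sup>2 = 0"
    using sq_int by (subst (asm) integral_nonneg_eq_0_iff_AE) auto
  then show ?thesis by simp
qed

section \<open>Both vectors as multiples of \<open>top_coeff d\<close>, and the conclusion\<close>

lemma binomial_card_plaquettes:
  assumes "0 \<le> p" "p \<le> 1"
  shows "map_pmf (\<lambda>\<omega>. card {z \<in> corners d n. \<omega> z}) (plaquette_pmf d n p) = binomial_pmf (n ^ d) p"
  unfolding plaquette_pmf_def using assms
  by (intro binomial_pmf_altdef'[symmetric]) (auto simp: card_corners)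

text \<open>The contribution of one open \<open>d\<close>-cube to the \<open>j\<close>-th intrinsic volume.\<close>

definition top_coeff :: "nat \<Rightarrow> nat \<Rightarrow> real" where
  "top_coeff d j = (-1) ^ (d - j) * real (d choose j)"

lemma W_vec_eq_line:
  assumes p: "0 \<le> p" "p \<le> 1"
  shows "W_vec d n p \<omega> = line (d + 1) (top_coeff d)
    (real n powr (- real d / 2) * (real (card {z \<in> corners d n. \<omega> z}) - real (n ^ d) * p))"
proof
  fix j
  let ?B = "\<lambda>\<omega>. card {z \<in> corners d n. \<omega> z}" and ?P = "plaquette_pmf d n p"
  show "W_vec d n p \<omega> j = line (d + 1) (top_coeff d)
    (real n powr (- real d / 2) * (real (?B \<omega>) - real (n ^ d) * p)) j"
  proof (cases "j \<le> d")
    case True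
    \<comment> \<open>\<open>c\<close> collects the lower-dimensional cubes, which are always
      present. It does not depend on the configuration, so the centring removes it.\<close>
    obtain c where c: "\<And>\<omega>. intrinsic_volume d n j (plaquette_set d n \<omega>) = c + top_coeff d j * real (?B \<omega>)"
      unfolding top_coeff_def by (rule intrinsic_volume_eq[of d n j]) blast
    have int: "integrable (binomial_pmf (n ^ d) p) f" for f :: "nat \<Rightarrow> real" using p by auto
    have "measure_pmf.expectation ?P (\<lambda>\<omega>. c + top_coeff d j * real (?B \<omega>)) =
        measure_pmf.expectation (map_pmf ?B ?P) (\<lambda>m. c + top_coeff d j * real m)" by simp
    also have "\<dots> = c + top_coeff d j * (real (n ^ d) * p)"
      unfolding binomial_card_plaquettes[OF p]
      using binomial_pmf_moments(1)[OF p, of "n ^ d"] int by simp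
    finally have "normalized_volume d n p j \<omega> = real n powr (- real d / 2) *
        (c + top_coeff d j * real (?B \<omega>) - (c + top_coeff d j * (real (n ^ d) * p)))"
      unfolding normalized_volume_def c by simp
    then show ?thesis using True by (simp add: W_vec_def line_def algebra_simps)
  qed (simp add: W_vec_def line_def)
qed

text \<open>Exhibits the rank one structure. The exponents \<open>(d - i) + (d - j)\<close> and
  \<open>i + j\<close> have the same parity, so the signs agree.\<close>

lemma Sigma_mat_eq:
  assumes "i \<le> d" "j \<le> d"
  shows "Sigma_mat d p i j = top_coeff d i * top_coeff d j * (p * (1 - p))"
proof -
  have "(-1::real) ^ (d - i) * (-1) ^ (d - j) = (-1) ^ (i + j)"
    using assms by (simp add: minus_one_power_iff)
  then show ?thesis by (simp add: Sigma_mat_def top_coeff_def mult_ac)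
qed

lemma integral_W_vec:
  assumes g: "g \<in> d4_test_functions (d + 1)" and p: "0 < p" "p < 1"
  shows "(\<integral>x. g x \<partial>distr (measure_pmf (plaquette_pmf d n p)) (Rvec (d + 1)) (W_vec d n p)) =
    measure_pmf.expectation (binomial_pmf (n ^ d) p)
      (\<lambda>k. g (line (d + 1) (top_coeff d) (real n powr (- real d / 2) * (real k - real (n ^ d) * p))))"
proof -
  note [measurable] = borel_measurable_d4_test_function[OF g]
  have [measurable]: "W_vec d n p \<in> measure_pmf (plaquette_pmf d n p) \<rightarrow>\<^sub>M Rvec (d + 1)"
    using p by (auto simp: W_vec_eq_line Rvec_def space_PiM)
  have "(\<integral>x. g x \<partial>distr (measure_pmf (plaquette_pmf d n p)) (Rvec (d + 1)) (W_vec d n p)) =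
      measure_pmf.expectation (plaquette_pmf d n p) (\<lambda>\<omega>. g (W_vec d n p \<omega>))"
    by (rule integral_distr) measurable
  also have "\<dots> = measure_pmf.expectation
      (map_pmf (\<lambda>\<omega>. card {z \<in> corners d n. \<omega> z}) (plaquette_pmf d n p))
      (\<lambda>k. g (line (d + 1) (top_coeff d) (real n powr (- real d / 2) * (real k - real (n ^ d) * p))))"
    unfolding integral_map_pmf by (simp only: W_vec_eq_line[OF less_imp_le[OF p(1)] less_imp_le[OF p(2)]])
  finally show ?thesis
    unfolding binomial_card_plaquettes[OF less_imp_le[OF p(1)] less_imp_le[OF p(2)]] .
qed

text \<open>The last coordinate serves as reference because \<open>top_coeff d d = 1\<close>: its
  variance is \<open>p * (1 - p)\<close>, and every other coordinate is almost surely
  \<open>top_coeff d i\<close> times it. Hence \<open>g\<close> sees only the normal variable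
  \<open>x d\<close>.\<close>

lemma integral_gaussian:
  assumes g: "g \<in> d4_test_functions (d + 1)" and p: "0 < p" "p < 1"
    and \<nu>: "centred_gaussian (d + 1) (Sigma_mat d p) \<nu>"
  shows "(\<integral>x. g x \<partial>\<nu>) =
    (\<integral>z. g (line (d + 1) (top_coeff d) z) \<partial>normal_measure (sqrt (p * (1 - p))))"
proof -
  note [measurable] = borel_measurable_d4_test_function[OF g]
  have [measurable]: "(\<lambda>x. x d) \<in> borel_measurable (Rvec (d + 1))"
    by (rule measurable_Rvec_component) simp
  have sets[measurable_cong]: "sets \<nu> = sets (Rvec (d + 1))" using \<nu> by (simp add: centred_gaussian_def)
  have [simp]: "top_coeff d d = 1" by (simp add: top_coeff_def)
  obtain \<sigma> where \<sigma>: "0 \<le> \<sigma>" "Sigma_mat d p d d = \<sigma>\<^sup>2" "distr \<nu> borel (\<lambda>x. x d) = normal_law 0 \<sigma>"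
    using centred_gaussian_component[OF \<nu>, of d] by auto
  have "\<sigma>\<^sup>2 = p * (1 - p)" using \<sigma>(2) by (simp add: Sigma_mat_eq)
  then have "\<sigma> = sqrt (p * (1 - p))" "\<sigma> \<noteq> 0" using \<sigma>(1) p by (auto simp: real_sqrt_unique)
  then have law: "distr \<nu> borel (\<lambda>x. x d) = normal_measure (sqrt (p * (1 - p)))"
    using \<sigma>(3) by (simp add: normal_law_def normal_measure_def)
  have "AE x in \<nu>. x i = top_coeff d i * x d" if "i \<in> {..<d + 1}" for i
    using that by (intro AE_component_eq_of_covariance[OF \<nu>]) (auto simp: Sigma_mat_eq power2_eq_square)
  then have "AE x in \<nu>. \<forall>i\<in>{..<d + 1}. x i = top_coeff d i * x d"
    by (rule AE_finite_allI[OF finite_lessThan])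
  \<comment> \<open>Needed for equality of whole functions: outside \<open>{..<d + 1}\<close> both
    sides are \<open>undefined\<close>.\<close>
  moreover have "AE x in \<nu>. x \<in> {..<d + 1} \<rightarrow>\<^sub>E UNIV"
    using sets_eq_imp_space_eq[OF sets] by (intro AE_I2) (simp add: Rvec_def space_PiM)
  ultimately have "AE x in \<nu>. g x = g (line (d + 1) (top_coeff d) (x d))"
  proof eventually_elim
    case (elim x)
    have "x = line (d + 1) (top_coeff d) (x d)"
    proof
      fix i show "x i = line (d + 1) (top_coeff d) (x d) i"
        using bspec[OF elim(1), of i] PiE_arb[OF elim(2), of i]
        by (cases "i < d + 1")
           (simp_all only: line_def restrict_def lessThan_iff if_True if_False not_False_eq_True)
    qed
    then show ?case by (rule arg_cong)
  qed
  then have "(\<integral>x. g x \<partial>\<nu>) = (\<integral>x. g (line (d + 1) (top_coeff d) (x d)) \<partial>\<nu>)"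
    by (rule integral_cong_AE[rotated 2]) measurable
  also have "\<dots> = (\<integral>z. g (line (d + 1) (top_coeff d) z) \<partial>distr \<nu> borel (\<lambda>x. x d))"
    by (rule integral_distr[symmetric]) measurable
  finally show ?thesis by (simp add: law)
qed

theorem theorem4p9:
  fixes d :: nat and p :: real
  assumes "d \<ge> 1" and "0 < p" and "p < 1"
  shows "\<exists>C::real. \<forall>n\<ge>3. \<forall>\<nu>. centred_gaussian (d + 1) (Sigma_mat d p) \<nu> \<longrightarrow>
    d4 (d + 1) (distr (measure_pmf (plaquette_pmf d n p)) (Rvec (d + 1)) (W_vec d n p)) \<nu>
      \<le> ereal (C / real n powr (real d / 2))"
proof -
  \<comment> \<open>The absolute values of the coefficients are the binomials
    \<open>d choose i\<close> with sum \<open>2 ^ d\<close>, so the final constant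
    \<open>3 * K\<close> equals \<open>3 * 8 ^ d\<close>.\<close>
  define K where "K = (\<Sum>i<d + 1. \<bar>top_coeff d i\<bar>) ^ 3"
  have "d4 (d + 1) (distr (measure_pmf (plaquette_pmf d n p)) (Rvec (d + 1)) (W_vec d n p)) \<nu>
      \<le> ereal (3 * K / real n powr (real d / 2))"
    if n: "n \<ge> 3" and \<nu>: "centred_gaussian (d + 1) (Sigma_mat d p) \<nu>" for n :: nat and \<nu>
    unfolding d4_def
  proof (intro SUP_least)
    fix g assume g: "g \<in> d4_test_functions (d + 1)"
    note [measurable] = borel_measurable_d4_test_function[OF g]
    have meas: "(\<lambda>t. g (line (d + 1) (top_coeff d) t)) \<in> borel_measurable borel" by measurable
    define \<delta> where "\<delta> = real n powr (- real d / 2)"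
    have \<delta>: "\<delta> > 0" using n by (simp add: \<delta>_def)
    have "\<delta>\<^sup>2 = real n powr (- real d)" by (simp add: \<delta>_def power2_eq_square powr_add[symmetric])
    \<comment> \<open>This normalisation gives the Gaussian the variance \<open>p * (1 - p)\<close>.
      It also reduces the total cost of \<open>n ^ d\<close> exchanges at
      \<open>3 * K * \<delta> ^ 3\<close> each to \<open>3 * K * \<delta>\<close>.\<close>
    then have \<delta>2: "real (n ^ d) * \<delta>\<^sup>2 = 1" using n by (simp add: powr_minus powr_realpow)
    obtain N where N: "n ^ d = Suc N" using n not0_implies_Suc[of "n ^ d"] by auto
    have var: "real (Suc N) * (\<delta>\<^sup>2 * (p * (1 - p))) = p * (1 - p)"
      unfolding mult.assoc[symmetric] N[symmetric] \<delta>2 by simp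
    have "real (Suc N) * (3 * K * \<delta> ^ 3) = (real (n ^ d) * \<delta>\<^sup>2) * (3 * K * \<delta>)"
      unfolding N by (simp add: power3_eq_cube power2_eq_square)
    also have "\<dots> = 3 * K / real n powr (real d / 2)"
      unfolding \<delta>2 by (simp add: \<delta>_def powr_minus_divide)
    finally have "real (Suc N) * (3 * K * \<delta> ^ 3) = 3 * K / real n powr (real d / 2)" .
    moreover have "\<bar>measure_pmf.expectation (binomial_pmf (Suc N) p)
        (\<lambda>k. g (line (d + 1) (top_coeff d) (0 + \<delta> * (real k - real (Suc N) * p)))) -
      (\<integral>z. g (line (d + 1) (top_coeff d) (0 + z)) \<partial>normal_measure
        (sqrt (real (Suc N) * (\<delta>\<^sup>2 * (p * (1 - p))))))\<bar> \<le> real (Suc N) * (3 * K * \<delta> ^ 3)"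
      unfolding K_def
      by (rule lindeberg_binomial_normal[OF cubic_expansion_line[OF g] meas assms(2,3) \<delta>])
    ultimately show "ereal \<bar>(\<integral>x. g x \<partial>distr (measure_pmf (plaquette_pmf d n p)) (Rvec (d + 1)) (W_vec d n p))
        - (\<integral>x. g x \<partial>\<nu>)\<bar> \<le> ereal (3 * K / real n powr (real d / 2))"
      unfolding integral_W_vec[OF g assms(2,3)] integral_gaussian[OF g assms(2,3) \<nu>] N \<delta>_def[symmetric]
      by (simp only: var add_0 ereal_less_eq(3))
  qed
  then show ?thesis by blast
qed

end
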